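(* Let $a\ge2$ be an integer and let $u=\alpha-1$. The set $\mathcal{R}_a$ induces a periodic tiling of the plane $\mathbb{C}$ modulo $\mathbb{Z}u+\mathbb{Z}\alpha u$; that is, $\mathbb{C}=\bigcup_{v\in\mathbb{Z}u+\mathbb{Z}\alpha u}(\mathcal{R}_a+v)$, and if $v,w\in\mathbb{Z}u+\mathbb{Z}\alpha u$ satisfy $\operatorname{int}(\mathcal{R}_a+v)\cap(\mathcal{R}_a+w)\ne\emptyset$ then $v=w$. Moreover $$\partial\mathcal{R}_a=\bigcup_{v\in B}\mathcal{R}_a\cap(\mathcal{R}_a+v),\qquad B=\{\pm u,\ \pm\alpha u,\ \pm(1+\alpha)u,\ \pm(1-\alpha)u\},$$ and $$\mathcal{R}_a\cap(\mathcal{R}_a+(1+\alpha)u)=\{-1\},\qquad \mathcal{R}_a\cap(\mathcal{R}_a+(\alpha-1)u)=\{-\alpha\}.$$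
   Context: Let $a\ge2$ be an integer and write $x^3-ax^2+x-1=(x-\beta)(x-\alpha)(x-\gamma)$ with $\beta>1$ real and $\alpha,\gamma\in\mathbb{C}\setminus\mathbb{R}$ complex conjugates, $|\alpha|<1$. $\mathcal{R}_a$ is the set of all $\sum_{i=2}^\infty\varepsilon_i\alpha^i$ with $\varepsilon_i\in\{0,\dots,a-1\}$ and $\varepsilon_i\varepsilon_{i-1}\varepsilon_{i-2}\varepsilon_{i-3}<_{lex}(a-1)(a-1)01$ for all $i\ge2$, where $\varepsilon_1=\varepsilon_0=\varepsilon_{-1}=0$ and $<_{lex}$ is the lexicographic order on finite words. $\partial$ and $\operatorname{int}$ denote topological boundary and interior in $\mathbb{C}$. *)

theory Defs
  imports "HOL-Analysis.Analysis"
begin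

(* Digit sequences are indexed by the integers, so that the windows at i = 2, 3, 4 can refer to the
   zero digits at the indices 1, 0, -1; digits at indices below -1 are irrelevant. Both words have
   length four, so the prefix clause of lexord never applies. *)
definition admissible :: "int \<Rightarrow> (int \<Rightarrow> int) \<Rightarrow> bool" where
  "admissible a \<epsilon> \<longleftrightarrow>
     \<epsilon> 1 = 0 \<and> \<epsilon> 0 = 0 \<and> \<epsilon> (-1) = 0 \<and>
     (\<forall>i\<ge>2. \<epsilon> i \<in> {0..a - 1} \<and>
        ([\<epsilon> i, \<epsilon> (i - 1), \<epsilon> (i - 2), \<epsilon> (i - 3)], [a - 1, a - 1, 0, 1]) \<in> lexord {(x, y). x < y})"

definition Rtile :: "int \<Rightarrow> complex \<Rightarrow> complex set" where
  "Rtile a \<alpha> =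
     {z. \<exists>\<epsilon>. admissible a \<epsilon> \<and> (\<lambda>n. of_int (\<epsilon> (int n + 2)) * \<alpha> ^ (n + 2)) sums z}"

definition int_span2 :: "complex \<Rightarrow> complex \<Rightarrow> complex set" where
  "int_span2 p q = {of_int m * p + of_int n * q | m n. True}"

definition translate :: "complex set \<Rightarrow> complex \<Rightarrow> complex set" where
  "translate S v = (\<lambda>z. z + v) ` S"

end

theory Submission
  imports Defs
begin

text \<open>
The geometry reduces to integer arithmetic through two constructions.

\<^emph>\<open>Carries.\<close> Suppose that a point has two expansions,
$\sum s_k\alpha^{k+2} = \sum s'_k\alpha^{k+2} + v$ with $v = mu + n\alpha u$. Dividing the difference
formally by $x^3 - ax^2 + x - 1$ leaves integers $E_k$ with $E_0 = n$, $E_1 = -m$, $E_2 = -E_0$ and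
$E_{k+3} = -(s_k - s'_k) + E_{k+2} - aE_{k+1} + E_k$. The tail of the series from position $k$ on is a
combination of $E_k, E_{k+1}, E_{k+2}$ with coefficients in $\mathbb{Z}[\alpha]$, and its imaginary part is a fixed multiple of
$E_{k+1} - \beta E_{k+2}$. Tails are bounded and $\beta > 1$, so $E$ is bounded
(\<open>carries_of_coincidence\<close>). The recursion is so expanding that a bounded solution is tiny: it
satisfies $|E_k| \le 2$, and where 2 occurs, the digits violate the admissibility condition. So all
$|E_k| \le 1$ (\<open>carry_le_1\<close>). In particular $|m|, |n| \le 1$, and the nonzero $v$ with this
property are exactly the eight vectors of $B$. If $|m| = |n| = 1$, then the recursion leaves no choice,
the carries and the digits have period 4, and the intersection is a single point.

\<^emph>\<open>Weights.\<close> Modulo the lattice every power $\alpha^i$ is congruent to an integer $w_i$. With these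
weights the admissible finite words form a numeration system: every $N \ge 0$ is
$\sum s_i w_{i+2}$ for exactly one of them (\<open>digit_expansion_exists\<close>, \<open>digit_value_inject\<close>).
Existence shows that every element of $\mathbb{Z}[\alpha]$ of nonnegative weight lies in some translate
of the tile; these elements are dense and the union of the translates is closed, so the
translates cover the plane. Uniqueness, together with $|E_k| \le 1$, shows that a point with a
finite expansion lies in no other translate (\<open>finite_expansion_unique\<close>): the difference of the two
digit values is a combination of three consecutive weights with coefficients given by the
carries, and its size contradicts the bounds on digit values unless the carries die out. Finite
expansions are dense in the tile, hence the interior of a translate meets no other translate.

The frontier is then the set of points that the tile shares with the other translates, and
these are the eight neighbours.
\<close>

section \<open>Digit sequences\<close>

text \<open>
Position \<open>n\<close> holds the digit $\varepsilon_{n+2}$. For digits between 0 and $a-1$ the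
lexicographic condition says that below two adjacent maximal digits come two zeros; since
the positions below 0 hold zeros anyway, only windows inside the natural numbers matter.
\<close>

definition digits :: "int \<Rightarrow> (nat \<Rightarrow> int) \<Rightarrow> bool" where
  "digits a s \<longleftrightarrow>
     (\<forall>n. 0 \<le> s n \<and> s n \<le> a - 1) \<and>
     (\<forall>n. s (n + 2) = a - 1 \<longrightarrow> s (n + 1) = a - 1 \<longrightarrow> s n = 0) \<and>
     (\<forall>n. s (n + 3) = a - 1 \<longrightarrow> s (n + 2) = a - 1 \<longrightarrow> s n = 0)"

lemma digits_nonneg: "digits a s \<Longrightarrow> 0 \<le> s n"
  and digits_le: "digits a s \<Longrightarrow> s n \<le> a - 1"
  and digits_top2: "digits a s \<Longrightarrow> s (n + 2) = a - 1 \<Longrightarrow> s (n + 1) = a - 1 \<Longrightarrow> s n = 0"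
  and digits_top3: "digits a s \<Longrightarrow> s (n + 3) = a - 1 \<Longrightarrow> s (n + 2) = a - 1 \<Longrightarrow> s n = 0"
  unfolding digits_def by blast+

lemma lex_window_iff:
  fixes A :: int
  assumes "x \<le> A" "y \<le> A" "0 \<le> z" "0 \<le> w"
  shows "([x, y, z, w], [A, A, 0, 1]) \<in> lexord {(x, y). x < y} \<longleftrightarrow>
    (x = A \<longrightarrow> y = A \<longrightarrow> z = 0 \<and> w = 0)"
proof -
  have step: "((p # ps, q # qs) \<in> lexord {(x, y). x < y}) = (p < q \<or> p = q \<and> (ps, qs) \<in> lexord {(x, y). x < y})"
    for p q :: int and ps qs
    unfolding lexord_cons_cons mem_Collect_eq prod.case by (rule refl)
  have "([x, y, z, w], [A, A, 0, 1]) \<in> lexord {(x, y). x < y} \<longleftrightarrow>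
    x < A \<or> x = A \<and> (y < A \<or> y = A \<and> (z < 0 \<or> z = 0 \<and> (w < 1 \<or> w = 1 \<and> False)))"
    by (simp only: step lexord_Nil_right)
  also have "\<dots> \<longleftrightarrow> (x = A \<longrightarrow> y = A \<longrightarrow> z = 0 \<and> w = 0)"
    using assms by presburger
  finally show ?thesis .
qed

lemma admissible_imp_digits:
  assumes "a \<ge> 2" "admissible a \<epsilon>"
  shows "digits a (\<lambda>n. \<epsilon> (int n + 2))"
proof -
  have zero: "\<epsilon> 1 = 0" "\<epsilon> 0 = 0" "\<epsilon> (-1) = 0"
    and rng2: "\<And>i. i \<ge> 2 \<Longrightarrow> \<epsilon> i \<in> {0..a - 1}"
    and win: "\<And>i. i \<ge> 2 \<Longrightarrow>
      ([\<epsilon> i, \<epsilon> (i - 1), \<epsilon> (i - 2), \<epsilon> (i - 3)], [a - 1, a - 1, 0, 1]) \<in> lexord {(x, y). x < y}"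
    using assms(2) unfolding admissible_def by blast+
  have rng: "0 \<le> \<epsilon> i" "\<epsilon> i \<le> a - 1" if "i \<ge> -1" for i
  proof -
    have "i \<ge> 2 \<or> i = -1 \<or> i = 0 \<or> i = 1" using that by linarith
    then consider "i \<ge> 2" | "i = -1" | "i = 0" | "i = 1" by blast
    then have "0 \<le> \<epsilon> i \<and> \<epsilon> i \<le> a - 1"
      by cases (use rng2[of i] zero assms(1) in simp_all)
    then show "0 \<le> \<epsilon> i" "\<epsilon> i \<le> a - 1" by simp_all
  qed
  have lex: "\<epsilon> (i - 2) = 0 \<and> \<epsilon> (i - 3) = 0"
    if "i \<ge> 2" "\<epsilon> i = a - 1" "\<epsilon> (i - 1) = a - 1" for i
  proof -
    have "([\<epsilon> i, \<epsilon> (i - 1), \<epsilon> (i - 2), \<epsilon> (i - 3)], [a - 1, a - 1, 0, 1]) \<in> lexord {(x, y). x < y} \<longleftrightarrow>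
      (\<epsilon> i = a - 1 \<longrightarrow> \<epsilon> (i - 1) = a - 1 \<longrightarrow> \<epsilon> (i - 2) = 0 \<and> \<epsilon> (i - 3) = 0)"
      by (rule lex_window_iff) (rule rng, use that(1) in linarith)+
    then show ?thesis
      using win[OF that(1)] that(2,3) by blast
  qed
  show ?thesis
    unfolding digits_def
  proof (intro conjI allI impI)
    fix n :: nat
    assume "\<epsilon> (int (n + 2) + 2) = a - 1" "\<epsilon> (int (n + 1) + 2) = a - 1"
    then show "\<epsilon> (int n + 2) = 0"
      using lex[of "int n + 4"] by (simp add: algebra_simps)
  next
    fix n :: nat
    assume "\<epsilon> (int (n + 3) + 2) = a - 1" "\<epsilon> (int (n + 2) + 2) = a - 1"
    then show "\<epsilon> (int n + 2) = 0"
      using lex[of "int n + 5"] by (simp add: algebra_simps)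
  next
    fix n :: nat
    show "0 \<le> \<epsilon> (int n + 2)" "\<epsilon> (int n + 2) \<le> a - 1"
      using rng[of "int n + 2"] by simp_all
  qed
qed

lemma digits_imp_admissible:
  assumes "a \<ge> 2" "digits a s"
  shows "admissible a (\<lambda>i. if i \<ge> 2 then s (nat (i - 2)) else 0)"
proof -
  define e :: "int \<Rightarrow> int" where "e = (\<lambda>i. if i \<ge> 2 then s (nat (i - 2)) else 0)"
  have e_nat: "e (int n + 2) = s n" for n
    by (simp add: e_def)
  have e_low: "e i = 0" if "i < 2" for i
    using that by (simp add: e_def)
  have rng: "0 \<le> e j" "e j \<le> a - 1" for j
    using digits_nonneg[OF assms(2)] digits_le[OF assms(2)] assms(1) by (auto simp: e_def)
  have win: "([e i, e (i - 1), e (i - 2), e (i - 3)], [a - 1, a - 1, 0, 1]) \<in> lexord {(x, y). x < y}"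
    if "i \<ge> 2" for i
  proof (subst lex_window_iff[OF rng(2) rng(2) rng(1) rng(1)], intro impI conjI)
    assume top: "e i = a - 1" "e (i - 1) = a - 1"
    show "e (i - 2) = 0"
    proof (cases "i \<ge> 4")
      case True
      then obtain n where n: "i = int n + 4"
        using zle_iff_zadd[of 4 i] by (auto simp: add.commute)
      show ?thesis
        using top digits_top2[OF assms(2), of n] e_nat[of n] e_nat[of "n + 1"] e_nat[of "n + 2"] n
        by (simp add: algebra_simps)
    qed (simp add: e_low)
    show "e (i - 3) = 0"
    proof (cases "i \<ge> 5")
      case True
      then obtain n where n: "i = int n + 5"
        using zle_iff_zadd[of 5 i] by (auto simp: add.commute)
      show ?thesis
        using top digits_top3[OF assms(2), of n] e_nat[of n] e_nat[of "n + 2"] e_nat[of "n + 3"] n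
        by (simp add: algebra_simps)
    qed (simp add: e_low)
  qed
  have "admissible a e"
    unfolding admissible_def
  proof (intro conjI allI impI)
    fix i :: int assume "i \<ge> 2"
    then show "([e i, e (i - 1), e (i - 2), e (i - 3)], [a - 1, a - 1, 0, 1]) \<in> lexord {(x, y). x < y}"
      by (rule win)
    show "e i \<in> {0..a - 1}" using rng by simp
  qed (simp_all add: e_low)
  then show ?thesis by (simp add: e_def)
qed

lemma Rtile_eq_digit_sums:
  assumes "a \<ge> 2"
  shows "Rtile a \<alpha> = {z. \<exists>s. digits a s \<and> (\<lambda>n. of_int (s n) * \<alpha> ^ (n + 2)) sums z}"
proof (intro equalityI subsetI)
  fix z assume "z \<in> Rtile a \<alpha>"
  then obtain \<epsilon> where "admissible a \<epsilon>" "(\<lambda>n. of_int (\<epsilon> (int n + 2)) * \<alpha> ^ (n + 2)) sums z"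
    unfolding Rtile_def by blast
  then show "z \<in> {z. \<exists>s. digits a s \<and> (\<lambda>n. of_int (s n) * \<alpha> ^ (n + 2)) sums z}"
    using admissible_imp_digits[OF assms] by (intro CollectI exI[of _ "\<lambda>n. \<epsilon> (int n + 2)"]) simp
next
  fix z assume "z \<in> {z. \<exists>s. digits a s \<and> (\<lambda>n. of_int (s n) * \<alpha> ^ (n + 2)) sums z}"
  then obtain s where s: "digits a s" "(\<lambda>n. of_int (s n) * \<alpha> ^ (n + 2)) sums z"
    by blast
  then show "z \<in> Rtile a \<alpha>"
    unfolding Rtile_def
    using digits_imp_admissible[OF assms s(1)]
    by (intro CollectI exI[of _ "\<lambda>i. if i \<ge> 2 then s (nat (i - 2)) else 0"]) simp
qed

section \<open>The numeration system of the weights\<close>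

text \<open>
The residues of the powers of $\alpha$ modulo the lattice: $\alpha - 1$ and $\alpha^2 - 1$
belong to it, and the recursion is the cubic equation of $\alpha$.
\<close>

fun weight :: "int \<Rightarrow> nat \<Rightarrow> int" where
  "weight a 0 = 1"
| "weight a (Suc 0) = 1"
| "weight a (Suc (Suc 0)) = 1"
| "weight a (Suc (Suc (Suc n))) = a * weight a (n + 2) - weight a (n + 1) + weight a n"

definition digit_value :: "int \<Rightarrow> (nat \<Rightarrow> int) \<Rightarrow> nat \<Rightarrow> int" where
  "digit_value a s k = (\<Sum>i<k. s i * weight a (i + 2))"

lemma weight_mono_pos:
  assumes "a \<ge> 2"
  shows "1 \<le> weight a n \<and> weight a n \<le> weight a (n + 1) \<and> weight a (n + 1) \<le> weight a (n + 2)
     \<and> weight a (n + 2) < weight a (n + 3)"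
proof (induction n)
  case 0
  then show ?case using assms by (simp add: numeral_eq_Suc)
next
  case (Suc n)
  let ?w = "weight a"
  have "?w (n + 4) = a * ?w (n + 3) - ?w (n + 2) + ?w (n + 1)"
    by (simp add: numeral_eq_Suc)
  moreover have "2 * ?w (n + 3) \<le> a * ?w (n + 3)"
    using assms Suc by (intro mult_right_mono) linarith+
  ultimately have "?w (n + 3) < ?w (n + 4)"
    using Suc by linarith
  then show ?case
    using Suc by (simp add: numeral_eq_Suc)
qed

lemma weight_pos: "a \<ge> 2 \<Longrightarrow> 1 \<le> weight a n"
  using weight_mono_pos by blast

lemma weight_mono: "a \<ge> 2 \<Longrightarrow> m \<le> n \<Longrightarrow> weight a m \<le> weight a n"
  by (rule lift_Suc_mono_le[of "weight a"]) (use weight_mono_pos[of a] in auto)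

lemma weight_ge_index: "a \<ge> 2 \<Longrightarrow> int n \<le> weight a (n + 2)"
proof (induction n)
  case (Suc n)
  then show ?case using weight_mono_pos[of a n] by (simp add: numeral_eq_Suc)
qed simp

text \<open>
The recursion for $(x+1)(x^3-ax^2+x-1) = x^4-(a-1)x^3-(a-1)x^2-1$, whose coefficients spell the
bounding word $(a-1)(a-1)01$.
\<close>

lemma weight_split:
  "weight a (n + 4) = (a - 1) * weight a (n + 3) + (a - 1) * weight a (n + 2) + weight a n"
  by (simp add: numeral_eq_Suc algebra_simps)

lemma digit_value_0 [simp]: "digit_value a s 0 = 0"
  by (simp add: digit_value_def)

lemma digit_value_Suc: "digit_value a s (Suc k) = digit_value a s k + s k * weight a (k + 2)"
  by (simp add: digit_value_def)

lemma digit_value_nonneg: "a \<ge> 2 \<Longrightarrow> digits a s \<Longrightarrow> 0 \<le> digit_value a s k"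
  unfolding digit_value_def
  by (intro sum_nonneg mult_nonneg_nonneg) (auto simp: digits_nonneg intro: order_trans[OF _ weight_pos])

lemma digit_value_cong: "(\<And>i. i < k \<Longrightarrow> s i = s' i) \<Longrightarrow> digit_value a s k = digit_value a s' k"
  by (simp add: digit_value_def)

lemma digit_value_extend:
  assumes "\<And>i. i \<ge> k \<Longrightarrow> s i = 0" "k \<le> n"
  shows "digit_value a s n = digit_value a s k"
  unfolding digit_value_def using assms by (intro sum.mono_neutral_right) auto

text \<open>
The largest word of length \<open>k\<close> starts with two maximal digits followed by two zeros, so that
\<open>weight_split\<close> leaves exactly one smaller weight of room for the rest; with a smaller first or second
digit the induction hypothesis for the remaining word suffices.
\<close>

lemma digit_value_less:
  assumes a: "a \<ge> 2" and s: "digits a s"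
  shows "digit_value a s k < weight a (k + 2)"
proof (induction k rule: less_induct)
  case (less k)
  note pos = weight_pos[OF a]
  consider "k = 0" | "k = 1" | m where "k = Suc (Suc m)"
    by (metis One_nat_def not0_implies_Suc)
  then show ?case
  proof cases
    case 1
    then show ?thesis using pos by simp
  next
    case 2
    then show ?thesis
      using digits_le[OF s, of 0] by (simp add: digit_value_Suc numeral_eq_Suc)
  next
    case (3 m)
    let ?w = "weight a" and ?v = "digit_value a s"
    have w4: "?w (k + 2) = (a - 1) * ?w (m + 3) + (a - 1) * ?w (m + 2) + ?w m"
      using weight_split[of a m] 3 by (simp add: numeral_eq_Suc)
    have v1: "?v k = ?v (m + 1) + s (m + 1) * ?w (m + 3)"
      using 3 digit_value_Suc[of a s "m + 1"] by (simp add: numeral_eq_Suc)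
    have v2: "?v (m + 1) = ?v m + s m * ?w (m + 2)"
      using digit_value_Suc[of a s m] by simp
    have nn: "0 \<le> (a - 1) * ?w (m + 2)"
      using a pos[of "m + 2"] by simp
    consider "s (m + 1) \<le> a - 2" | "s (m + 1) = a - 1" "s m \<le> a - 2" | "s (m + 1) = a - 1" "s m = a - 1"
      using digits_le[OF s, of m] digits_le[OF s, of "m + 1"] by linarith
    then show ?thesis
    proof cases
      case 1
      have "s (m + 1) * ?w (m + 3) \<le> (a - 2) * ?w (m + 3)"
        using 1 pos[of "m + 3"] by (intro mult_right_mono) auto
      moreover have "?v (m + 1) < ?w (m + 3)"
        using less[of "m + 1"] 3 by (simp add: numeral_eq_Suc)
      ultimately show ?thesis
        unfolding v1 w4 using nn pos[of m] by (simp add: algebra_simps)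
    next
      case 2
      have "s m * ?w (m + 2) \<le> (a - 2) * ?w (m + 2)"
        using 2 pos[of "m + 2"] by (intro mult_right_mono) auto
      moreover have "?v m < ?w (m + 2)"
        using less[of m] 3 by simp
      ultimately show ?thesis
        unfolding v1 v2 w4 2(1) using pos[of m] by (simp add: algebra_simps)
    next
      case top: 3
      have "?v m < ?w m"
      proof -
        consider "m = 0" | "m = 1" | j where "m = Suc (Suc j)"
          by (metis One_nat_def not0_implies_Suc)
        then show ?thesis
        proof cases
          case 2
          have "s 0 = 0"
            using digits_top2[OF s, of 0] top 2 by (simp add: numeral_eq_Suc)
          then show ?thesis using 2 by (simp add: digit_value_Suc)
        next
          case (3 j)
          have "s (j + 1) = 0" "s j = 0"
            using digits_top2[OF s, of "j + 1"] digits_top3[OF s, of j] top 3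
            by (simp_all add: numeral_eq_Suc)
          then have "?v m = ?v j"
            using 3 by (simp add: digit_value_Suc)
          then show ?thesis
            using less[of j] 3 \<open>k = Suc (Suc m)\<close> by simp
        qed simp
      qed
      then show ?thesis
        unfolding v1 v2 w4 top by (simp add: algebra_simps)
    qed
  qed
qed

text \<open>
By \<open>digit_value_less\<close> the leading digit is the quotient by the leading weight.
\<close>

lemma digit_value_inject:
  assumes a: "a \<ge> 2" and s: "digits a s" "digits a s'"
  shows "digit_value a s k = digit_value a s' k \<Longrightarrow> i < k \<Longrightarrow> s i = s' i"
proof (induction k arbitrary: i)
  case (Suc k)
  let ?W = "weight a (k + 2)" and ?v = "digit_value a s k" and ?v' = "digit_value a s' k"
  have eq: "?v + s k * ?W = ?v' + s' k * ?W"
    using Suc.prems(1) by (simp add: digit_value_Suc)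
  have b: "0 \<le> ?v" "?v < ?W" "0 \<le> ?v'" "?v' < ?W"
    using digit_value_nonneg[OF a] digit_value_less[OF a] s by blast+
  have "s k = (?v + s k * ?W) div ?W" "s' k = (?v' + s' k * ?W) div ?W"
    using b by simp_all
  then have top: "s k = s' k" using eq by simp
  then have "?v = ?v'" using eq by simp
  then show ?case
    using Suc.IH Suc.prems(2) top by (cases "i = k") auto
qed simp

lemma digits_zero: "a \<ge> 2 \<Longrightarrow> digits a (\<lambda>_. 0)"
  by (simp add: digits_def del: One_nat_def)

lemma digits_update:
  assumes "a \<ge> 2" "digits a s" and zero: "\<And>i. i \<ge> k \<Longrightarrow> s i = 0" and c: "0 \<le> c" "c < a - 1"
  shows "digits a (s(k := c))"
proof -
  let ?t = "s(k := c)"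
  have below: "i < k" if "?t i = a - 1" for i
    using that zero[of i] c assms(1) by (cases "i < k") (auto split: if_splits)
  show ?thesis
    unfolding digits_def
  proof (intro conjI allI impI)
    fix n
    show "0 \<le> ?t n" "?t n \<le> a - 1"
      using digits_nonneg[OF assms(2)] digits_le[OF assms(2)] c by auto
  next
    fix n assume t: "?t (n + 2) = a - 1" "?t (n + 1) = a - 1"
    then show "?t n = 0"
      using below[OF t(1)] digits_top2[OF assms(2), of n] by simp
  next
    fix n assume t: "?t (n + 3) = a - 1" "?t (n + 2) = a - 1"
    then show "?t n = 0"
      using below[OF t(1)] digits_top3[OF assms(2), of n] by simp
  qed
qed

text \<open>
A maximal digit may be put on top of a word unless the word itself starts with a maximal
digit that is not followed by two zeros.
\<close>

lemma digits_update_top: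
  assumes "a \<ge> 2" "digits a s"
    and zero: "\<And>i. i \<ge> k \<Longrightarrow> s i = 0"
    and below_top: "\<And>i j. k = Suc j \<Longrightarrow> s j = a - 1 \<Longrightarrow> i < j \<Longrightarrow> j \<le> i + 2 \<Longrightarrow> s i = 0"
  shows "digits a (s(k := a - 1))"
proof -
  let ?t = "s(k := a - 1)"
  have below: "i \<le> k" if "?t i = a - 1" for i
    using that zero[of i] assms(1) by (cases "i \<le> k") (auto split: if_splits)
  show ?thesis
    unfolding digits_def
  proof (intro conjI allI impI)
    fix n
    show "0 \<le> ?t n" "?t n \<le> a - 1"
      using digits_nonneg[OF assms(2)] digits_le[OF assms(2)] assms(1) by auto
  next
    fix n assume t: "?t (n + 2) = a - 1" "?t (n + 1) = a - 1"
    then show "?t n = 0"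
      using below[OF t(1)] digits_top2[OF assms(2), of n] below_top[of "n + 1" n]
      by (cases "n + 2 = k") simp_all
  next
    fix n assume t: "?t (n + 3) = a - 1" "?t (n + 2) = a - 1"
    then show "?t n = 0"
      using below[OF t(1)] digits_top3[OF assms(2), of n] below_top[of "n + 2" n]
      by (cases "n + 3 = k") simp_all
  qed
qed

lemma division_bounds:
  fixes N W b :: int
  assumes "0 \<le> N" "N < b * W" "1 \<le> W"
  shows "0 \<le> N div W" "N div W < b" "0 \<le> N mod W" "N mod W < W" "N = N div W * W + N mod W"
proof -
  show "0 \<le> N mod W" "0 \<le> N div W" "N mod W < W" "N = N div W * W + N mod W"
    using assms by (simp_all add: pos_imp_zdiv_nonneg_iff)
  then have "N div W * W < b * W"
    using assms(2) by linarith
  then show "N div W < b"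
    using assms(3) by (simp add: mult_less_cancel_right)
qed

text \<open>
The greedy algorithm, with the terms of \<open>weight_split\<close> as the thresholds that decide
whether the first digit, and then the second, is maximal.
\<close>

lemma digit_expansion_exists:
  assumes a: "a \<ge> 2"
  shows "0 \<le> N \<Longrightarrow> N < weight a (k + 2) \<Longrightarrow>
    \<exists>s. digits a s \<and> (\<forall>i\<ge>k. s i = 0) \<and> digit_value a s k = N"
proof (induction k arbitrary: N rule: less_induct)
  case (less k)
  note pos = weight_pos[OF a]
  consider "k = 0" | "k = 1" | m where "k = Suc (Suc m)"
    by (metis One_nat_def not0_implies_Suc)
  then show ?case
  proof cases
    case 1
    then have "N = 0" using less.prems by (simp add: numeral_eq_Suc)
    then show ?thesis
      using 1 digits_zero[OF a] by (intro exI[of _ "\<lambda>_. 0"]) simp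
  next
    case 2
    then have N: "N \<le> a - 1" using less.prems by (simp add: numeral_eq_Suc)
    have "digits a ((\<lambda>_. 0)(0 := N))"
    proof (cases "N = a - 1")
      case True
      then show ?thesis using digits_update_top[OF a digits_zero[OF a], of 0] by simp
    next
      case False
      then show ?thesis using digits_update[OF a digits_zero[OF a], of 0 N] N less.prems(1) by simp
    qed
    then show ?thesis
      using 2 by (intro exI[of _ "(\<lambda>_. 0)(0 := N)"] conjI) (simp_all del: fun_upd_apply, simp_all add: digit_value_Suc numeral_eq_Suc)
  next
    case (3 m)
    let ?w = "weight a" and ?v = "digit_value a"
    have w4: "?w (k + 2) = (a - 1) * ?w (m + 3) + (a - 1) * ?w (m + 2) + ?w m"
      using weight_split[of a m] 3 by (simp add: numeral_eq_Suc)
    have v1: "?v s k = ?v s m + s m * ?w (m + 2) + s (Suc m) * ?w (m + 3)" for s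
      using 3 by (simp add: digit_value_Suc numeral_eq_Suc)
    show ?thesis
    proof (cases "N < (a - 1) * ?w (m + 3)")
      case True
      define c r where "c = N div ?w (m + 3)" and "r = N mod ?w (m + 3)"
      have c: "0 \<le> c" "c < a - 1"
        and r: "0 \<le> r" "r < ?w (m + 3)" and cr: "N = c * ?w (m + 3) + r"
        unfolding c_def r_def using division_bounds[OF less.prems(1) True pos] by simp_all
      from r obtain s where s: "digits a s" "\<forall>i\<ge>m + 1. s i = 0" "?v s (m + 1) = r"
        using less.IH[of "m + 1" r] 3 by (auto simp: numeral_eq_Suc)
      let ?s = "s(Suc m := c)"
      have "digits a ?s"
        using digits_update[OF a s(1) _ c] s(2) by simp
      moreover have "?v ?s k = N"
      proof -
        have "?v ?s k = ?v ?s (m + 1) + c * ?w (m + 3)"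
          using 3 digit_value_Suc[of a ?s "m + 1"] by (simp add: numeral_eq_Suc)
        also have "?v ?s (m + 1) = r"
          using s(3) digit_value_cong[of "m + 1" ?s s a] by simp
        finally show ?thesis using cr by linarith
      qed
      moreover have "\<forall>i\<ge>k. ?s i = 0"
        using s(2) 3 by simp
      ultimately show ?thesis by blast
    next
      case False
      define N' where "N' = N - (a - 1) * ?w (m + 3)"
      have N': "0 \<le> N'" "N' < (a - 1) * ?w (m + 2) + ?w m"
        using False less.prems(2) w4 by (auto simp: N'_def)
      show ?thesis
      proof (cases "N' < (a - 1) * ?w (m + 2)")
        case True
        define c r where "c = N' div ?w (m + 2)" and "r = N' mod ?w (m + 2)"
        have c: "0 \<le> c" "c < a - 1"
          and r: "0 \<le> r" "r < ?w (m + 2)" and cr: "N' = c * ?w (m + 2) + r"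
          unfolding c_def r_def using division_bounds[OF N'(1) True pos] by simp_all
        from r obtain s where s: "digits a s" "\<forall>i\<ge>m. s i = 0" "?v s m = r"
          using less.IH[of m r] 3 by auto
        let ?s = "s(m := c, Suc m := a - 1)"
        have "digits a (s(m := c))"
          using digits_update[OF a s(1) _ c] s(2) by simp
        then have "digits a ?s"
          by (rule digits_update_top[OF a]) (use s(2) c in auto)
        moreover have "?v ?s k = N"
        proof -
          have "?v ?s m = r"
            using s(3) digit_value_cong[of m ?s s a] by simp
          then have "?v ?s k = r + c * ?w (m + 2) + (a - 1) * ?w (m + 3)"
            by (simp add: v1)
          then show ?thesis using cr N'_def by linarith
        qed
        moreover have "\<forall>i\<ge>k. ?s i = 0"
          using s(2) 3 by simp
        ultimately show ?thesis by blast
      next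
        case False
        define N'' where "N'' = N' - (a - 1) * ?w (m + 2)"
        have N'': "0 \<le> N''" "N'' < ?w m"
          using False N' by (auto simp: N''_def)
        obtain s where s: "digits a s" "\<forall>i\<ge>m - 2. s i = 0" "?v s m = N''"
        proof -
          consider "m < 2" | j where "m = j + 2"
            by (metis add.commute le_Suc_ex not_less)
          then show ?thesis
          proof cases
            case 1
            then have "m = 0 \<or> m = 1" by auto
            then have "?w m = 1" by auto
            then have "N'' = 0" using N'' by simp
            moreover have "?v (\<lambda>_. 0) m = 0" by (simp add: digit_value_def)
            ultimately show ?thesis
              using that[of "\<lambda>_. 0"] digits_zero[OF a] by simp
          next
            case (2 j)
            then obtain s where s: "digits a s" "\<forall>i\<ge>j. s i = 0" "?v s j = N''"
              using less.IH[of j N''] N'' 3 by auto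
            moreover have "?v s m = ?v s j"
              using s(2) 2 by (intro digit_value_extend) auto
            ultimately show ?thesis
              using that[of s] 2 by simp
          qed
        qed
        let ?s = "s(m := a - 1, Suc m := a - 1)"
        have "digits a (s(m := a - 1))"
          by (rule digits_update_top[OF a s(1)]) (use s(2) a in auto)
        then have "digits a ?s"
          by (rule digits_update_top[OF a]) (use s(2) a in auto)
        moreover have "?v ?s k = N"
        proof -
          have "?v ?s m = N''"
            using s(3) digit_value_cong[of m ?s s a] by simp
          then show ?thesis
            by (simp add: v1 N''_def N'_def)
        qed
        moreover have "\<forall>i\<ge>k. ?s i = 0"
          using s(2) 3 by simp
        ultimately show ?thesis by blast
      qed
    qed
  qed
qed

section \<open>Bounded carries\<close>

text \<open>
What the carry recursion $x = -d + z - ay + p$ with $|d| \le a-1$ says about four consecutive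
carries \<open>p\<close>, \<open>y\<close>, \<open>z\<close>, \<open>x\<close>, in a form that does not mention $a$: only the bound in the direction
that pulls \<open>y\<close> back is kept, as it reads for $a = 2$, and for larger $a$ it holds all the more. A nonzero \<open>y\<close> has to be compensated by its
neighbours with about twice its size, which makes large carries grow until they exceed any bound.
\<close>

definition restoring :: "int \<Rightarrow> int \<Rightarrow> int \<Rightarrow> int \<Rightarrow> bool" where
  "restoring p y z x \<longleftrightarrow>
     (y \<ge> 1 \<longrightarrow> z + p - x \<ge> 2 * y - 1) \<and> (y \<le> -1 \<longrightarrow> z + p - x \<le> 2 * y + 1)"

lemma restoring_minus: "restoring p y z x \<Longrightarrow> restoring (- p) (- y) (- z) (- x)"
  unfolding restoring_def by linarith

lemma restoring_if_small_digit:
  assumes "a \<ge> 2" "\<bar>d\<bar> \<le> a - 1" "x = - d + z - a * y + p"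
  shows "restoring p y z x"
proof -
  have "2 * y - 1 \<le> a * y - (a - 1)" if "y \<ge> 1"
    using mult_nonneg_nonneg[of "a - 2" "y - 1"] assms(1) that by (simp add: algebra_simps)
  moreover have "a * y + (a - 1) \<le> 2 * y + 1" if "y \<le> -1"
    using mult_nonneg_nonneg[of "a - 2" "- 1 - y"] assms(1) that by (simp add: algebra_simps)
  ultimately show ?thesis
    using assms(2,3) unfolding restoring_def by linarith
qed

text \<open>
Here and below \<open>x\<^sub>i\<close> stands for the carry at index \<open>i\<close> and \<open>M\<close> for the largest absolute value;
\<open>- x2\<close> is the carry at index 0, because the carries start with $E_2 = -E_0$. If the maximum were
attained at the index in the lemma name, the inequalities would force the following carries to
oscillate with growing amplitude and to pass \<open>M\<close> after a few indices.
\<close>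

lemma maximum_at_1:
  assumes "M \<ge> 2" "restoring (- x2) M x2 x3" "\<bar>x2\<bar> \<le> M" "\<bar>x3\<bar> \<le> M"
  shows False
  using assms unfolding restoring_def by linarith

lemma maximum_at_2:
  assumes "M \<ge> 2" "restoring (- M) x1 M x3" "restoring x1 M x3 x4" "restoring M x3 x4 x5"
    "restoring x3 x4 x5 x6" "restoring x4 x5 x6 x7"
    "\<bar>x1\<bar> \<le> M" "\<bar>x3\<bar> \<le> M" "\<bar>x4\<bar> \<le> M" "\<bar>x5\<bar> \<le> M" "\<bar>x6\<bar> \<le> M" "\<bar>x7\<bar> \<le> M"
  shows False
  using assms [[smt_timeout = 300]] unfolding restoring_def by (smt (z3))

lemma maximum_at_3:
  assumes "M \<ge> 3" "restoring (- x2) x1 x2 M" "restoring x1 x2 M x4" "restoring x2 M x4 x5"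
    "restoring M x4 x5 x6" "restoring x4 x5 x6 x7" "restoring x5 x6 x7 x8" "restoring x6 x7 x8 x9"
    "\<bar>x1\<bar> \<le> M" "\<bar>x2\<bar> \<le> M" "\<bar>x4\<bar> \<le> M" "\<bar>x5\<bar> \<le> M" "\<bar>x6\<bar> \<le> M" "\<bar>x7\<bar> \<le> M" "\<bar>x8\<bar> \<le> M" "\<bar>x9\<bar> \<le> M"
  shows False
  using assms [[smt_timeout = 300]] unfolding restoring_def by (smt (z3))

text \<open>
From index 4 on the start of the sequence is out of sight; four indices before the maximum and six
after it are enough.
\<close>

lemma maximum_in_the_interior:
  assumes "M \<ge> 3" "restoring x0 x1 x2 x3" "restoring x1 x2 x3 x4" "restoring x2 x3 x4 x5"
    "restoring x3 x4 x5 x6" "restoring x4 x5 x6 x7" "restoring x5 x6 x7 x8" "restoring x6 x7 x8 x9"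
    "restoring x7 x8 x9 x10"
    "\<bar>x0\<bar> \<le> M" "\<bar>x1\<bar> \<le> M" "\<bar>x2\<bar> \<le> M" "\<bar>x3\<bar> \<le> M" "x4 = M" "\<bar>x5\<bar> \<le> M" "\<bar>x6\<bar> \<le> M"
    "\<bar>x7\<bar> \<le> M" "\<bar>x8\<bar> \<le> M" "\<bar>x9\<bar> \<le> M" "\<bar>x10\<bar> \<le> M"
  shows False
  using assms [[smt_timeout = 300]] unfolding restoring_def by (smt (z3))

text \<open>
The value 2 does occur in bounded solutions of the inequalities after carries of size at most 1,
but only inside the pattern $0, 1, 2, 1, -1$; any other continuation leaves the range within seven
indices.
\<close>

lemma neighbourhood_of_two:
  assumes "restoring x0 x1 x2 2" "restoring x1 x2 2 x4" "restoring x2 2 x4 x5" "restoring 2 x4 x5 x6"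
    "restoring x4 x5 x6 x7" "restoring x5 x6 x7 x8" "restoring x6 x7 x8 x9" "restoring x7 x8 x9 x10"
    "\<bar>x0\<bar> \<le> 1" "\<bar>x1\<bar> \<le> 1" "\<bar>x2\<bar> \<le> 1"
    "\<bar>x4\<bar> \<le> 2" "\<bar>x5\<bar> \<le> 2" "\<bar>x6\<bar> \<le> 2" "\<bar>x7\<bar> \<le> 2" "\<bar>x8\<bar> \<le> 2" "\<bar>x9\<bar> \<le> 2" "\<bar>x10\<bar> \<le> 2"
  shows "x1 = 0 \<and> x2 = 1 \<and> x4 = 1 \<and> x5 = -1"
  using assms [[smt_timeout = 300]] unfolding restoring_def by (smt (z3))

text \<open>
A maximum at index 0 also occurs, with the opposite sign, at index 2; hence \<open>j \<ge> 1\<close> is no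
restriction.
\<close>

lemma carry_maximum_le_2:
  fixes E :: "nat \<Rightarrow> int"
  assumes res: "\<And>k. restoring (E k) (E (k + 1)) (E (k + 2)) (E (k + 3))"
    and start: "E 2 = - E 0" and bound: "\<And>k. \<bar>E k\<bar> \<le> M" and max: "E j = M" and j: "j \<ge> 1"
  shows "M \<le> 2 \<and> (M = 2 \<longrightarrow> j \<ge> 3)"
proof (rule ccontr)
  assume "\<not> ?thesis"
  then have M: "M \<ge> 3 \<or> M = 2 \<and> j \<le> 2" by linarith
  have "j = 1 \<or> j = 2 \<or> j = 3 \<or> j \<ge> 4" using j by linarith
  then consider "j = 1" | "j = 2" | "j = 3" | m where "j = m + 4"
    by (metis add.commute le_Suc_ex)
  then show False
  proof cases
    case 1
    show False
      by (rule maximum_at_1[of M "E 2" "E 3"])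
         (use M 1 max start bound res[of 0] in \<open>simp_all add: numeral_eq_Suc, linarith?\<close>)
  next
    case 2
    have "E 0 = - M" "M \<ge> 2" using start max 2 M by auto
    then show False
      using maximum_at_2[of M "E 1" "E 3" "E 4" "E 5" "E 6" "E 7"] M 2 max bound
        res[of 0] res[of 1] res[of 2] res[of 3] res[of 4] by (simp add: numeral_eq_Suc)
  next
    case 3
    have "E 0 = - E 2" using start by simp
    then show False
      using maximum_at_3[of M "E 2" "E 1" "E 4" "E 5" "E 6" "E 7" "E 8" "E 9"] M 3 max bound
        res[of 0] res[of 1] res[of 2] res[of 3] res[of 4] res[of 5] res[of 6] by (simp add: numeral_eq_Suc)
  next
    case (4 m)
    then show False
      using maximum_in_the_interior[of M "E m" "E (m + 1)" "E (m + 2)" "E (m + 3)" "E (m + 4)" "E (m + 5)" "E (m + 6)"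
          "E (m + 7)" "E (m + 8)" "E (m + 9)" "E (m + 10)"] M max bound
        res[of m] res[of "m + 1"] res[of "m + 2"] res[of "m + 3"] res[of "m + 4"] res[of "m + 5"]
        res[of "m + 6"] res[of "m + 7"] by (simp add: numeral_eq_Suc)
  qed
qed

lemma carry_le_2:
  fixes E :: "nat \<Rightarrow> int"
  assumes res: "\<And>k. restoring (E k) (E (k + 1)) (E (k + 2)) (E (k + 3))"
    and start: "E 2 = - E 0" and bound: "\<And>k. \<bar>E k\<bar> \<le> C"
  shows "\<bar>E k\<bar> \<le> 2 \<and> (\<bar>E k\<bar> = 2 \<longrightarrow> k \<ge> 3)"
proof -
  have fin: "finite (range (\<lambda>k. \<bar>E k\<bar>))"
    by (rule finite_subset[of _ "{0..C}"]) (use bound in auto)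
  define M where "M = Max (range (\<lambda>k. \<bar>E k\<bar>))"
  have bM: "\<bar>E k\<bar> \<le> M" for k
    unfolding M_def using fin by (intro Max_ge) auto
  have le2: "M \<le> 2 \<and> (M = 2 \<longrightarrow> i \<ge> 3)" if i: "\<bar>E i\<bar> = M" for i
  proof -
    obtain j where j: "\<bar>E j\<bar> = M" "j \<ge> 1" "j = i \<or> i = 0 \<and> j = 2"
      using i start by (cases "i = 0") force+
    have "M \<le> 2 \<and> (M = 2 \<longrightarrow> j \<ge> 3)"
    proof (cases "E j = M")
      case True
      then show ?thesis
        using carry_maximum_le_2[of E M j, OF res start bM] j(2) by blast
    next
      case False
      then have "- E j = M" using j(1) by linarith
      moreover have "restoring (- E k) (- E (k + 1)) (- E (k + 2)) (- E (k + 3))" for k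
        by (rule restoring_minus) (rule res)
      ultimately show ?thesis
        using carry_maximum_le_2[of "\<lambda>k. - E k" M j] start bM j(2) by simp
    qed
    then show ?thesis using j(3) by auto
  qed
  have "M \<in> range (\<lambda>k. \<bar>E k\<bar>)"
    unfolding M_def using fin by (intro Max_in) auto
  then have "M \<le> 2" using le2 by force
  then show ?thesis
    using bM[of k] le2[of k] by linarith
qed

text \<open>
Inserted into the recursion, the pattern of \<open>neighbourhood_of_two\<close> forces $a = 2$ and three
consecutive digit differences $-1$. Then \<open>s'\<close> has three consecutive digits $1 = a - 1$, which
admissibility forbids.
\<close>

lemma carry_neq_2:
  fixes E s s' :: "nat \<Rightarrow> int"
  assumes a: "a \<ge> 2" and s: "digits a s" and s': "digits a s'"
    and E: "\<And>k. E (k + 3) = - (s k - s' k) + E (k + 2) - a * E (k + 1) + E k"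
    and start: "E 2 = - E 0" and bound: "\<And>k. \<bar>E k\<bar> \<le> 2"
    and before: "\<And>i. i < k + 3 \<Longrightarrow> \<bar>E i\<bar> \<le> 1"
  shows "E (k + 3) \<noteq> 2"
proof
  assume two: "E (k + 3) = 2"
  have D: "\<bar>s k - s' k\<bar> \<le> a - 1" for k
    using digits_nonneg[OF s, of k] digits_le[OF s, of k] digits_nonneg[OF s', of k] digits_le[OF s', of k]
    by linarith
  have res: "restoring (E k) (E (k + 1)) (E (k + 2)) (E (k + 3))" for k
    by (rule restoring_if_small_digit[OF a D E])
  have nb: "E (k + 1) = 0 \<and> E (k + 2) = 1 \<and> E (k + 4) = 1 \<and> E (k + 5) = -1"
    by (rule neighbourhood_of_two[of "E k" _ _ _ _ "E (k + 6)" "E (k + 7)" "E (k + 8)" "E (k + 9)" "E (k + 10)"])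
       (use res[of k] res[of "k + 1"] res[of "k + 2"] res[of "k + 3"] res[of "k + 4"] res[of "k + 5"]
        res[of "k + 6"] res[of "k + 7"] before[of k] before[of "k + 1"] before[of "k + 2"] bound two
        in \<open>simp_all add: numeral_eq_Suc\<close>)
  have E34: "E (k + 4) = - (s (k + 1) - s' (k + 1)) + E (k + 3) - a * E (k + 2) + E (k + 1)"
    "E (k + 5) = - (s (k + 2) - s' (k + 2)) + E (k + 4) - a * E (k + 3) + E (k + 2)"
    using E[of "k + 1"] by (simp add: numeral_eq_Suc, use E[of "k + 2"] in \<open>simp add: numeral_eq_Suc\<close>)
  have pattern: "E (k + 1) = 0" "E (k + 2) = 1" "E (k + 4) = 1" "E (k + 5) = -1"
    using nb by blast+
  have Dk: "s k - s' k = E k - 1" "s (k + 1) - s' (k + 1) = 1 - a" "s (k + 2) - s' (k + 2) = 3 - 2 * a"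
    using E[of k] E34 unfolding pattern two by linarith+
  have a2: "a = 2"
    using Dk(3) D[of "k + 2"] a by linarith
  \<comment> \<open>A carry 1 in this place is incompatible with the start if \<open>k = 0\<close>, and needs a carry of size 2 at
    index \<open>k - 1\<close> otherwise.\<close>
  have "E k \<noteq> 1"
  proof
    assume Ek: "E k = 1"
    show False
    proof (cases k)
      case 0
      then show False using start Ek nb by (simp add: numeral_eq_Suc)
    next
      case (Suc i)
      then have "restoring (E i) 1 0 1"
        using res[of i] Ek nb by (simp add: numeral_eq_Suc)
      then show False
        using before[of i] Suc unfolding restoring_def by simp
    qed
  qed
  then have "s k - s' k = -1"
    using Dk(1) D[of k] a2 before[of k] by simp
  then have "s' k = 1" "s' (k + 1) = 1" "s' (k + 2) = 1"
    using Dk a2 digits_nonneg[OF s, of k] digits_nonneg[OF s, of "k + 1"] digits_nonneg[OF s, of "k + 2"]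
      digits_le[OF s', of k] digits_le[OF s', of "k + 1"] digits_le[OF s', of "k + 2"] by linarith+
  then show False
    using digits_top2[OF s', of k] a2 by simp
qed

theorem carry_le_1:
  fixes E s s' :: "nat \<Rightarrow> int"
  assumes a: "a \<ge> 2" and s: "digits a s" and s': "digits a s'"
    and E: "\<And>k. E (k + 3) = - (s k - s' k) + E (k + 2) - a * E (k + 1) + E k"
    and start: "E 2 = - E 0" and bound: "\<And>k. \<bar>E k\<bar> \<le> C"
  shows "\<bar>E k\<bar> \<le> 1"
proof (induction k rule: less_induct)
  case (less k)
  have D: "\<bar>s k - s' k\<bar> \<le> a - 1" for k
    using digits_nonneg[OF s, of k] digits_le[OF s, of k] digits_nonneg[OF s', of k] digits_le[OF s', of k]
    by linarith
  have res: "restoring (E k) (E (k + 1)) (E (k + 2)) (E (k + 3))" for k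
    by (rule restoring_if_small_digit[OF a D E])
  have le2: "\<bar>E i\<bar> \<le> 2" "\<bar>E i\<bar> = 2 \<Longrightarrow> i \<ge> 3" for i
    using carry_le_2[of E C i, OF res start bound] by auto
  show ?case
  proof (cases "k \<ge> 3")
    case True
    then obtain i where i: "k = i + 3"
      by (metis add.commute le_Suc_ex)
    have "E (i + 3) \<noteq> 2"
      by (rule carry_neq_2[OF a s s' E start le2(1)]) (use less i in simp)
    moreover have "- E (i + 3) \<noteq> 2"
      by (rule carry_neq_2[OF a s' s, of "\<lambda>k. - E k"]) (use E start le2 less i in auto)
    ultimately show ?thesis
      using le2(1)[of k] unfolding i by linarith
  next
    case False
    then show ?thesis using le2[of k] by linarith
  qed
qed

lemma restoring_carry:
  fixes E s s' :: "nat \<Rightarrow> int"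
  assumes a: "a \<ge> 2" and s: "digits a s" and s': "digits a s'"
    and E: "\<And>k. E (k + 3) = - (s k - s' k) + E (k + 2) - a * E (k + 1) + E k"
  shows "restoring (E k) (E (k + 1)) (E (k + 2)) (E (k + 3))"
proof (rule restoring_if_small_digit[OF a _ E])
  show "\<bar>s k - s' k\<bar> \<le> a - 1"
    using digits_nonneg[OF s, of k] digits_le[OF s, of k] digits_nonneg[OF s', of k] digits_le[OF s', of k]
    by linarith
qed

text \<open>
If $|E_k| = |E_{k+1}| = 1$ and $E_{k+2} = -E_k$, then the neighbours of $E_{k+1}$ cancel each other, and only
$E_{k+3} = -E_{k+1}$ can compensate it. The digit differences are then $\pm(a-1)$, which
determines both digits.
\<close>

lemma corner_carries:
  fixes E s s' :: "nat \<Rightarrow> int"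
  assumes a: "a \<ge> 2" and s: "digits a s" and s': "digits a s'"
    and E: "\<And>k. E (k + 3) = - (s k - s' k) + E (k + 2) - a * E (k + 1) + E k"
    and start: "E 2 = - E 0" and bound: "\<And>k. \<bar>E k\<bar> \<le> 1"
    and corner: "\<bar>E 0\<bar> = 1" "\<bar>E 1\<bar> = 1"
  shows "E (k + 2) = - E k" "s k = (if E (k + 1) = -1 then a - 1 else 0)"
proof -
  have *: "E (k + 2) = - E k \<and> \<bar>E k\<bar> = 1 \<and> \<bar>E (k + 1)\<bar> = 1" for k
  proof (induction k)
    case 0
    then show ?case using start corner by (simp add: numeral_eq_Suc)
  next
    case (Suc k)
    have "restoring (E k) (E (k + 1)) (- E k) (E (k + 3))"
      using restoring_carry[OF a s s' E, of k] Suc by simp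
    then have "E (k + 3) = - E (k + 1)"
      using Suc bound[of "k + 3"] unfolding restoring_def by linarith
    then show ?case using Suc by (simp add: numeral_eq_Suc)
  qed
  then show "E (k + 2) = - E k" by blast
  have "E (k + 3) = - E (k + 1)" "E (k + 2) = - E k"
    using *[of k] *[of "k + 1"] by (simp_all add: numeral_eq_Suc)
  then have "s k - s' k = E (k + 1) - a * E (k + 1)"
    using E[of k] by simp
  then have "s k - s' k = (if E (k + 1) = -1 then a - 1 else 1 - a)"
    using *[of k] by (auto simp: abs_if split: if_splits)
  then show "s k = (if E (k + 1) = -1 then a - 1 else 0)"
    using digits_nonneg[OF s, of k] digits_le[OF s, of k] digits_nonneg[OF s', of k] digits_le[OF s', of k]
    by (auto split: if_splits)
qed

section \<open>The tile\<close>

text \<open>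
The last assumption says that the real root $\beta = a - 2\,\mathrm{Re}\,\alpha$ of the cubic exceeds 1.
\<close>

locale cubic_tile =
  fixes a :: int and \<alpha> :: complex
  assumes a: "a \<ge> 2"
    and root: "\<alpha> ^ 3 = of_int a * \<alpha> ^ 2 - \<alpha> + 1"
    and nonreal: "Im \<alpha> \<noteq> 0"
    and contracting: "norm \<alpha> < 1"
    and expanding: "of_int a - 2 * Re \<alpha> > 1"
begin

definition point :: "(nat \<Rightarrow> int) \<Rightarrow> complex" where
  "point s = (\<Sum>n. of_int (s n) * \<alpha> ^ (n + 2))"

definition tile :: "complex set" where
  "tile = point ` {s. digits a s}"

definition lattice :: "complex set" where
  "lattice = int_span2 (\<alpha> - 1) (\<alpha> * (\<alpha> - 1))"

lemma alpha_neq_0: "\<alpha> \<noteq> 0"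
  using nonreal by auto

lemma norm_term_le:
  assumes "\<And>n. \<bar>c n\<bar> \<le> C"
  shows "norm (of_int (c n) * \<alpha> ^ n) \<le> of_int C * norm \<alpha> ^ n"
  using assms[of n] by (simp add: norm_mult norm_power mult_right_mono del: of_int_abs flip: of_int_abs)

lemma summable_bounded:
  assumes "\<And>n. \<bar>c n\<bar> \<le> C"
  shows "summable (\<lambda>n. of_int (c n) * \<alpha> ^ n)"
  by (rule summable_comparison_test'[of "\<lambda>n. of_int C * norm \<alpha> ^ n" 0])
     (use contracting norm_term_le[of c C, OF assms] in \<open>auto intro: summable_mult summable_geometric\<close>)

lemma norm_power_series_le:
  assumes "\<And>n. \<bar>c n\<bar> \<le> C"
  shows "norm (\<Sum>n. of_int (c n) * \<alpha> ^ n) \<le> of_int C / (1 - norm \<alpha>)"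
proof -
  have "norm (\<Sum>n. of_int (c n) * \<alpha> ^ n) \<le> (\<Sum>n. of_int C * norm \<alpha> ^ n)"
    by (rule norm_suminf_le) (use contracting norm_term_le[of c C, OF assms] in \<open>auto intro: summable_mult summable_geometric\<close>)
  also have "\<dots> = of_int C / (1 - norm \<alpha>)"
    using contracting by (simp add: suminf_mult suminf_geometric summable_geometric)
  finally show ?thesis .
qed

lemma digits_abs_le: "digits a s \<Longrightarrow> \<bar>s n\<bar> \<le> a - 1"
  using digits_nonneg[of a s n] digits_le[of a s n] by linarith

lemma point_alt:
  assumes "\<And>n. \<bar>s n\<bar> \<le> C"
  shows "point s = \<alpha> ^ 2 * (\<Sum>n. of_int (s n) * \<alpha> ^ n)"
  unfolding point_def suminf_mult[OF summable_bounded[of s, OF assms], symmetric]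
  by (simp only: power_add mult_ac)

lemma sums_point:
  assumes "digits a s"
  shows "(\<lambda>n. of_int (s n) * \<alpha> ^ (n + 2)) sums point s"
proof -
  have "summable (\<lambda>n. \<alpha> ^ 2 * (of_int (s n) * \<alpha> ^ n))"
    using summable_bounded[of s, OF digits_abs_le[OF assms]] by (rule summable_mult)
  then have "summable (\<lambda>n. of_int (s n) * \<alpha> ^ (n + 2))"
    by (simp only: power_add mult_ac)
  then show ?thesis
    unfolding point_def by (rule summable_sums)
qed

lemma Rtile_eq_tile: "Rtile a \<alpha> = tile"
proof -
  have "z = point s" if "digits a s" "(\<lambda>n. of_int (s n) * \<alpha> ^ (n + 2)) sums z" for z s
    using sums_unique2[OF that(2) sums_point[OF that(1)]] .
  then show ?thesis
    unfolding Rtile_eq_digit_sums[OF a] tile_def using sums_point by blast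
qed

lemma power_series_split:
  assumes "\<And>n. \<bar>c n\<bar> \<le> C"
  shows "(\<Sum>n. of_int (c n) * \<alpha> ^ n) = of_int (c 0) + \<alpha> * (\<Sum>n. of_int (c (Suc n)) * \<alpha> ^ n)"
proof -
  have "(\<Sum>n. of_int (c n) * \<alpha> ^ n) = (\<Sum>n. of_int (c (Suc n)) * \<alpha> ^ Suc n) + of_int (c 0)"
    using suminf_split_head[OF summable_bounded[of c C, OF assms]] by simp
  also have "(\<Sum>n. of_int (c (Suc n)) * \<alpha> ^ Suc n) = \<alpha> * (\<Sum>n. of_int (c (Suc n)) * \<alpha> ^ n)"
    unfolding suminf_mult[OF summable_bounded[of "\<lambda>n. c (Suc n)" C, OF assms], symmetric]
    by (simp add: mult_ac)
  finally show ?thesis by simp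
qed

lemma point_Suc:
  assumes "\<And>n. \<bar>s n\<bar> \<le> C"
  shows "point s = of_int (s 0) * \<alpha> ^ 2 + \<alpha> * point (\<lambda>n. s (Suc n))"
  unfolding point_alt[of s, OF assms] point_alt[of "\<lambda>n. s (Suc n)", OF assms] power_series_split[of s, OF assms]
  by (simp add: algebra_simps)

lemma point_finite:
  assumes "\<And>i. i \<ge> k \<Longrightarrow> s i = 0"
  shows "point s = (\<Sum>i<k. of_int (s i) * \<alpha> ^ (i + 2))"
  unfolding point_def by (rule suminf_finite) (use assms in auto)

section \<open>Carries of a coincidence\<close>

text \<open>
The equation \<open>tail\<close> in the proof, the tail of the difference series as a combination of
three carries, holds at the start because of the initial values and is propagated by the
recursion and the cubic equation. Its coefficients $\alpha^2 - a\alpha + 1$ and $\alpha - a$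
have imaginary parts $-\beta\,\mathrm{Im}\,\alpha$ and $\mathrm{Im}\,\alpha$, so that
$\beta E_{k+2} - E_{k+1}$ is bounded; as $\beta > 1$, so is $E$.
\<close>

lemma carries_of_coincidence:
  assumes s: "digits a s" and s': "digits a s'"
    and diff: "point s - point s' = of_int m * (\<alpha> - 1) + of_int n * (\<alpha> * (\<alpha> - 1))"
  shows "\<exists>E. E 0 = n \<and> E 1 = - m \<and> E 2 = - E 0 \<and>
    (\<forall>k. E (k + 3) = - (s k - s' k) + E (k + 2) - a * E (k + 1) + E k) \<and> (\<forall>k. \<bar>E k\<bar> \<le> 1)"
proof -
  \<comment> \<open>The recursion of order three, as an iteration on triples of consecutive carries.\<close>
  define T where "T = rec_nat (n, - m, - n)
    (\<lambda>k (x, y, z). (y, z, - (s k - s' k) + z - a * y + x))"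
  define E where "E = (\<lambda>k. fst (T k))"
  have T: "T k = (E k, E (k + 1), E (k + 2))" for k
    by (cases "T k") (simp add: E_def T_def numeral_eq_Suc split: prod.split)
  have E0: "E 0 = n" "E 1 = - m" "E 2 = - E 0"
    by (simp_all add: E_def T_def numeral_eq_Suc)
  have rec: "E (k + 3) = - (s k - s' k) + E (k + 2) - a * E (k + 1) + E k" for k
  proof -
    have "T (k + 1) = (E (k + 1), E (k + 2), - (s k - s' k) + E (k + 2) - a * E (k + 1) + E k)"
      using T[of k] by (simp add: T_def)
    then show ?thesis using T[of "k + 1"] by (simp add: numeral_eq_Suc)
  qed
  define D where "D = (\<lambda>k. s k - s' k)"
  have D: "\<bar>D k\<bar> \<le> a - 1" for k
    using digits_nonneg[OF s, of k] digits_le[OF s, of k] digits_nonneg[OF s', of k] digits_le[OF s', of k]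
    unfolding D_def by linarith
  define tail where "tail = (\<lambda>k. \<Sum>i. of_int (D (k + i)) * \<alpha> ^ i)"
  have tail_Suc: "tail k = of_int (D k) + \<alpha> * tail (Suc k)" for k
    unfolding tail_def using power_series_split[of "\<lambda>i. D (k + i)", OF D] by simp
  \<comment> \<open>The product of the roots of the cubic is 1, so \<open>\<alpha>\<close> is a unit.\<close>
  have inverse: "\<alpha> * (1 - of_int a * \<alpha> + \<alpha> ^ 2) = 1"
    using root by (simp add: algebra_simps power2_eq_square power3_eq_cube)
  have tail_0: "\<alpha> ^ 2 * tail 0 = point s - point s'"
  proof -
    have "point s - point s' = \<alpha> ^ 2 * ((\<Sum>i. of_int (s i) * \<alpha> ^ i) - (\<Sum>i. of_int (s' i) * \<alpha> ^ i))"
      unfolding point_alt[of s, OF digits_abs_le[OF s]] point_alt[of s', OF digits_abs_le[OF s']]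
      by (simp add: right_diff_distrib)
    also have "(\<Sum>i. of_int (s i) * \<alpha> ^ i) - (\<Sum>i. of_int (s' i) * \<alpha> ^ i) = tail 0"
      unfolding tail_def D_def
      by (subst suminf_diff[OF summable_bounded[of s, OF digits_abs_le[OF s]]
            summable_bounded[of s', OF digits_abs_le[OF s']]])
         (simp add: left_diff_distrib)
    finally show ?thesis by simp
  qed
  have tail: "tail k = of_int (E (k + 2)) * (1 - of_int a * \<alpha> + \<alpha> ^ 2)
      + of_int (E (k + 1)) * (\<alpha> - of_int a) + of_int (E k)" for k
  proof (induction k)
    case 0
    have "\<alpha> ^ 2 * (of_int (E 2) * (1 - of_int a * \<alpha> + \<alpha> ^ 2) + of_int (E 1) * (\<alpha> - of_int a) + of_int (E 0))
      = of_int (E 2) * (\<alpha> * (\<alpha> * (1 - of_int a * \<alpha> + \<alpha> ^ 2)))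
        + of_int (E 1) * (\<alpha> ^ 3 - of_int a * \<alpha> ^ 2) + of_int (E 0) * \<alpha> ^ 2"
      by (simp add: algebra_simps power2_eq_square power3_eq_cube)
    also have "\<dots> = point s - point s'"
      unfolding inverse root E0 diff by (simp add: algebra_simps power2_eq_square)
    also have "\<dots> = \<alpha> ^ 2 * tail 0" using tail_0 by simp
    finally show ?case using alpha_neq_0 by (simp add: numeral_eq_Suc)
  next
    case (Suc k)
    let ?r = "of_int (E (k + 3)) * (1 - of_int a * \<alpha> + \<alpha> ^ 2)
      + of_int (E (k + 2)) * (\<alpha> - of_int a) + of_int (E (k + 1)) :: complex"
    have "\<alpha> * ?r = of_int (E (k + 3)) * (\<alpha> * (1 - of_int a * \<alpha> + \<alpha> ^ 2))
      + of_int (E (k + 2)) * (\<alpha> ^ 2 - of_int a * \<alpha>) + of_int (E (k + 1)) * \<alpha>"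
      by (simp add: algebra_simps power2_eq_square)
    also have "\<dots> = tail k - of_int (D k)"
      unfolding inverse Suc.IH rec D_def by (simp add: algebra_simps)
    also have "\<dots> = \<alpha> * tail (Suc k)"
      using tail_Suc[of k] by simp
    finally show ?case using alpha_neq_0 by (simp add: numeral_eq_Suc)
  qed
  define \<beta> where "\<beta> = of_int a - 2 * Re \<alpha>"
  define C where "C = of_int (a - 1) / (1 - norm \<alpha>) / \<bar>Im \<alpha>\<bar>"
  have step: "\<bar>of_int (E (k + 1)) - \<beta> * of_int (E (k + 2))\<bar> \<le> C" for k
  proof -
    have "Im (tail k) = Im \<alpha> * (of_int (E (k + 1)) - \<beta> * of_int (E (k + 2)))"
      unfolding tail \<beta>_def by (simp add: power2_eq_square algebra_simps)
    then have "\<bar>Im \<alpha>\<bar> * \<bar>of_int (E (k + 1)) - \<beta> * of_int (E (k + 2))\<bar> = \<bar>Im (tail k)\<bar>"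
      by (simp add: abs_mult)
    also have "\<dots> \<le> norm (tail k)" by (rule abs_Im_le_cmod)
    also have "\<dots> \<le> of_int (a - 1) / (1 - norm \<alpha>)"
      unfolding tail_def by (rule norm_power_series_le) (rule D)
    finally show ?thesis
      unfolding C_def using nonreal by (subst pos_le_divide_eq) (simp_all add: mult.commute)
  qed
  \<comment> \<open>The term \<open>C / (\<beta> - 1)\<close> is the fixed point of the estimate \<open>x \<mapsto> (x + C) / \<beta>\<close>.\<close>
  define K where "K = max (max \<bar>of_int (E 0)\<bar> \<bar>of_int (E 1)\<bar>) (C / (\<beta> - 1))"
  have \<beta>: "\<beta> > 1" using expanding by (simp add: \<beta>_def)
  have K: "\<bar>of_int (E (k + 1))\<bar> \<le> K" for k
  proof (induction k)
    case 0
    then show ?case by (simp add: K_def)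
  next
    case (Suc k)
    have "C / (\<beta> - 1) \<le> K" by (simp add: K_def)
    then have "C \<le> K * (\<beta> - 1)"
      using \<beta> by (simp add: divide_le_eq)
    moreover have "\<beta> * \<bar>of_int (E (k + 2))\<bar> = \<bar>\<beta> * of_int (E (k + 2))\<bar>"
      using \<beta> by (simp add: abs_mult)
    ultimately have "\<beta> * \<bar>of_int (E (k + 2))\<bar> \<le> \<beta> * K"
      using step[of k] Suc by (simp add: algebra_simps)
    then show ?case using \<beta> by (simp add: numeral_eq_Suc)
  qed
  have "\<bar>of_int (E k)\<bar> \<le> K" for k
  proof (cases k)
    case 0
    then show ?thesis by (simp add: K_def le_max_iff_disj)
  next
    case (Suc i)
    then show ?thesis using K[of i] by simp
  qed
  then have "\<bar>E k\<bar> \<le> \<lceil>K\<rceil>" for k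
    by (metis ceiling_mono ceiling_of_int of_int_abs)
  then have "\<bar>E k\<bar> \<le> 1" for k
    using carry_le_1[OF a s s', of E "\<lceil>K\<rceil>"] rec E0(3) by blast
  then show ?thesis
    using E0 rec by blast
qed

section \<open>Finite expansions lie in one tile only\<close>

text \<open>
The identity behind \<open>carries_of_coincidence\<close> with the weights in place of the powers of $\alpha$;
lattice vectors have weight 0.
\<close>

lemma digit_value_of_carries:
  assumes E: "\<And>k. E (k + 3) = - (s k - s' k) + E (k + 2) - a * E (k + 1) + E k"
    and start: "E 2 = - E 0"
  shows "digit_value a s n - digit_value a s' n =
    - E (n + 2) * weight a (n + 1) + E (n + 1) * (weight a (n + 1) - weight a n) - E n * weight a (n + 2)"
proof (induction n)
  case 0
  then show ?case using start by (simp add: numeral_eq_Suc)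
next
  case (Suc n)
  have w: "weight a (n + 3) = a * weight a (n + 2) - weight a (n + 1) + weight a n"
    by (simp add: numeral_eq_Suc)
  have D: "s n - s' n = - E (n + 3) + E (n + 2) - a * E (n + 1) + E n"
    using E[of n] by simp
  have "digit_value a s (Suc n) - digit_value a s' (Suc n) =
    (digit_value a s n - digit_value a s' n) + (s n - s' n) * weight a (n + 2)"
    by (simp add: digit_value_Suc left_diff_distrib)
  also have "\<dots> = - E (n + 3) * weight a (n + 2) + E (n + 2) * (weight a (n + 2) - weight a (n + 1))
      - E (n + 1) * weight a (n + 3)"
    unfolding Suc.IH D w by (simp add: algebra_simps)
  finally show ?case by (simp add: numeral_eq_Suc)
qed

text \<open>
Beyond the support of \<open>s\<close> its digit value is a constant, while that of \<open>s'\<close> stays between 0 and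
the next weight. By \<open>digit_value_of_carries\<close> a carry $-1$ at a late index would make the difference
larger than that constant, and a carry 1, once there are no more carries $-1$, would push it, there
or at the next index, down to minus the next weight or below. So the late carries vanish, the digit values agree and the
words coincide.
\<close>

lemma finite_expansion_unique:
  assumes s: "digits a s" and fin: "\<And>i. i \<ge> K \<Longrightarrow> s i = 0" and s': "digits a s'"
    and diff: "point s - point s' \<in> lattice"
  shows "s' = s"
proof -
  let ?w = "weight a" and ?v = "digit_value a"
  obtain m n where "point s - point s' = of_int m * (\<alpha> - 1) + of_int n * (\<alpha> * (\<alpha> - 1))"
    using diff unfolding lattice_def int_span2_def by blast
  then obtain E where E: "E 2 = - E 0" "\<And>k. \<bar>E k\<bar> \<le> 1"
    "\<And>k. E (k + 3) = - (s k - s' k) + E (k + 2) - a * E (k + 1) + E k"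
    using carries_of_coincidence[OF s s'] by metis
  note pos = weight_pos[OF a]
  have vs: "?v s k = ?v s K" "?v s K < ?w (k + 2)" "0 \<le> ?v s K" if "k \<ge> K" for k
    using digit_value_extend[of K s k a] fin that digit_value_less[OF a s, of k] digit_value_nonneg[OF a s] by auto
  have vs': "0 \<le> ?v s' k" "?v s' k < ?w (k + 2)" for k
    using digit_value_nonneg[OF a s'] digit_value_less[OF a s'] by auto
  have val: "?v s K - ?v s' k =
      - E (k + 2) * ?w (k + 1) + E (k + 1) * (?w (k + 1) - ?w k) - E k * ?w (k + 2)" if "k \<ge> K" for k
    using digit_value_of_carries[of E s s' k, OF E(3,1)] vs(1)[OF that] by simp
  have E_cases: "E k = -1 \<or> E k = 0 \<or> E k = 1" for k
    using E(2)[of k] by linarith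
  have nonneg: "E k \<noteq> -1" if k: "k \<ge> K + 3" for k
  proof
    assume "E k = -1"
    then have v: "?v s K - ?v s' k = - E (k + 2) * ?w (k + 1) + E (k + 1) * (?w (k + 1) - ?w k) + ?w (k + 2)"
      using val[of k] k by simp
    obtain p where p: "k = p + 1" "p \<ge> K + 2"
      using k by (metis Suc_eq_plus1 Suc_le_D Suc_le_mono add_Suc_right numeral_2_eq_2 numeral_3_eq_3)
    have "?w (k + 2) = a * ?w (k + 1) - ?w k + ?w p"
      using p(1) by (simp add: numeral_eq_Suc)
    moreover have "2 * ?w (k + 1) \<le> a * ?w (k + 1)"
      using a pos[of "k + 1"] by (intro mult_right_mono) auto
    moreover have "?w k \<le> ?w (k + 1)" by (rule weight_mono[OF a]) simp
    moreover have "- E (k + 2) * ?w (k + 1) \<ge> - ?w (k + 1)"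
      using E_cases[of "k + 2"] pos[of "k + 1"] by fastforce
    moreover have "E (k + 1) * (?w (k + 1) - ?w k) \<ge> - (?w (k + 1) - ?w k)"
      using E_cases[of "k + 1"] weight_mono[OF a, of k "k + 1"] by fastforce
    ultimately have "?w p \<le> ?v s K - ?v s' k"
      unfolding v by linarith
    moreover have "?v s K < ?w p"
      using vs(2)[of K] weight_mono[OF a p(2)] by linarith
    ultimately show False using vs'(1)[of k] by linarith
  qed
  have not_1_0: "\<not> (E k = 1 \<and> E (k + 1) = 0)" if k: "k \<ge> K + 3" for k
  proof
    assume "E k = 1 \<and> E (k + 1) = 0"
    then have "?v s K - ?v s' k = - E (k + 2) * ?w (k + 1) - ?w (k + 2)"
      using val[of k] k by simp
    moreover have "0 \<le> E (k + 2)"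
      using nonneg[of "k + 2"] E_cases[of "k + 2"] k by auto
    then have "0 \<le> E (k + 2) * ?w (k + 1)"
      using pos[of "k + 1"] by simp
    ultimately show False
      using vs'(2)[of k] vs(3)[of K] by simp
  qed
  have zero: "E k = 0" if k: "k \<ge> K + 3" for k
  proof (rule ccontr)
    assume "E k \<noteq> 0"
    then have 1: "E k = 1" using nonneg[OF k] E_cases[of k] by auto
    then have 2: "E (k + 1) = 1"
      using not_1_0[OF k] nonneg[of "k + 1"] E_cases[of "k + 1"] k by auto
    then have 3: "E (k + 2) = 1"
      using not_1_0[of "k + 1"] nonneg[of "k + 2"] E_cases[of "k + 2"] k by (auto simp: numeral_eq_Suc)
    have "?v s K - ?v s' k = - ?w k - ?w (k + 2)"
      using val[of k] k 1 2 3 by simp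
    then show False
      using vs'(2)[of k] vs(3)[of K] pos[of k] by simp
  qed
  have "s i = s' i" for i
  proof -
    define k where "k = max (K + 3) (Suc i)"
    have "?v s k = ?v s' k"
      using val[of k] vs(1)[of k] zero[of k] zero[of "k + 1"] zero[of "k + 2"] by (simp add: k_def)
    then show ?thesis
      using digit_value_inject[OF a s s', of k i] by (simp add: k_def)
  qed
  then show ?thesis by auto
qed

section \<open>The lattice\<close>

lemma lattice_iff: "x \<in> lattice \<longleftrightarrow> (\<exists>m n. x = of_int m * (\<alpha> - 1) + of_int n * (\<alpha> * (\<alpha> - 1)))"
  unfolding lattice_def int_span2_def by blast

lemma lattice_zero: "0 \<in> lattice"
  unfolding lattice_iff by (rule exI[of _ 0], rule exI[of _ 0]) simp

lemma lattice_add: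
  assumes "x \<in> lattice" "y \<in> lattice"
  shows "x + y \<in> lattice"
proof -
  obtain m n m' n' where "x = of_int m * (\<alpha> - 1) + of_int n * (\<alpha> * (\<alpha> - 1))"
    "y = of_int m' * (\<alpha> - 1) + of_int n' * (\<alpha> * (\<alpha> - 1))"
    using assms unfolding lattice_iff by blast
  then have "x + y = of_int (m + m') * (\<alpha> - 1) + of_int (n + n') * (\<alpha> * (\<alpha> - 1))"
    by (simp add: distrib_right)
  then show ?thesis unfolding lattice_iff by blast
qed

lemma lattice_of_int_mult:
  assumes "x \<in> lattice"
  shows "of_int c * x \<in> lattice"
proof -
  obtain m n where "x = of_int m * (\<alpha> - 1) + of_int n * (\<alpha> * (\<alpha> - 1))"
    using assms unfolding lattice_iff by blast
  then have "of_int c * x = of_int (c * m) * (\<alpha> - 1) + of_int (c * n) * (\<alpha> * (\<alpha> - 1))"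
    by (simp add: distrib_left mult.assoc)
  then show ?thesis unfolding lattice_iff by blast
qed

lemma lattice_minus: "x \<in> lattice \<Longrightarrow> - x \<in> lattice"
  using lattice_of_int_mult[of x "-1"] by simp

lemma lattice_diff: "x \<in> lattice \<Longrightarrow> y \<in> lattice \<Longrightarrow> x - y \<in> lattice"
  using lattice_add[of x "- y"] lattice_minus[of y] by simp

lemma lattice_sum: "(\<And>i. i \<in> I \<Longrightarrow> f i \<in> lattice) \<Longrightarrow> sum f I \<in> lattice"
  by (induction I rule: infinite_finite_induct) (auto intro: lattice_zero lattice_add)

lemma power_cong_weight: "\<alpha> ^ n - of_int (weight a n) \<in> lattice"
proof -
  let ?d = "\<lambda>n. \<alpha> ^ n - of_int (weight a n)"
  have "?d n \<in> lattice \<and> ?d (n + 1) \<in> lattice \<and> ?d (n + 2) \<in> lattice"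
  proof (induction n)
    case 0
    have "?d 1 \<in> lattice"
      unfolding lattice_iff by (rule exI[of _ 1], rule exI[of _ 0]) simp
    moreover have "?d 2 \<in> lattice"
      unfolding lattice_iff
      by (rule exI[of _ 1], rule exI[of _ 1]) (simp add: numeral_2_eq_2 algebra_simps)
    ultimately show ?case by (simp add: lattice_zero numeral_2_eq_2)
  next
    case (Suc n)
    have "\<alpha> ^ (n + 3) = \<alpha> ^ n * \<alpha> ^ 3" by (simp only: power_add)
    also have "\<dots> = of_int a * \<alpha> ^ (n + 2) - \<alpha> ^ (n + 1) + \<alpha> ^ n"
      unfolding root power_add by (simp add: algebra_simps)
    finally have "?d (n + 3) = of_int a * ?d (n + 2) - ?d (n + 1) + ?d n"
      by (simp add: numeral_eq_Suc algebra_simps)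
    then have "?d (n + 3) \<in> lattice"
      using Suc by (simp only: lattice_add lattice_diff lattice_of_int_mult)
    then show ?case using Suc by (simp add: numeral_eq_Suc)
  qed
  then show ?thesis by blast
qed

lemma lattice_discrete: "\<exists>\<delta>>0. \<forall>x\<in>lattice. x \<noteq> 0 \<longrightarrow> \<delta> \<le> norm x"
proof (intro exI conjI ballI impI)
  let ?\<delta> = "norm (\<alpha> - 1) * min 1 \<bar>Im \<alpha>\<bar>"
  show "0 < ?\<delta>" using nonreal by (auto simp: complex_eq_iff)
  fix x assume "x \<in> lattice" "x \<noteq> 0"
  then obtain m n where x: "x = of_int m * (\<alpha> - 1) + of_int n * (\<alpha> * (\<alpha> - 1))"
    unfolding lattice_iff by blast
  have "min 1 \<bar>Im \<alpha>\<bar> \<le> norm (of_int m + of_int n * \<alpha>)"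
  proof (cases "n = 0")
    case True
    then have "1 \<le> \<bar>real_of_int m\<bar>" using x \<open>x \<noteq> 0\<close> by (cases "m = 0") (auto simp flip: of_int_abs)
    then show ?thesis using True by simp
  next
    case False
    then have "1 \<le> \<bar>real_of_int n\<bar>" by (simp flip: of_int_abs)
    then have "\<bar>Im \<alpha>\<bar> \<le> \<bar>real_of_int n\<bar> * \<bar>Im \<alpha>\<bar>"
      using mult_right_mono[of 1 "\<bar>real_of_int n\<bar>" "\<bar>Im \<alpha>\<bar>"] by simp
    also have "\<dots> = \<bar>Im (of_int m + of_int n * \<alpha>)\<bar>" by (simp add: abs_mult)
    also have "\<dots> \<le> norm (of_int m + of_int n * \<alpha>)" by (rule abs_Im_le_cmod)
    finally show ?thesis by simp
  qed
  then have "?\<delta> \<le> norm (\<alpha> - 1) * norm (of_int m + of_int n * \<alpha>)"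
    by (intro mult_left_mono) auto
  also have "\<dots> = norm x"
    unfolding x norm_mult[symmetric] by (simp add: algebra_simps)
  finally show "?\<delta> \<le> norm x" .
qed

lemma closed_lattice_subset:
  assumes "S \<subseteq> lattice"
  shows "closed S"
proof -
  obtain \<delta> where \<delta>: "\<delta> > 0" "\<And>x. x \<in> lattice \<Longrightarrow> x \<noteq> 0 \<Longrightarrow> \<delta> \<le> norm x"
    using lattice_discrete by blast
  show ?thesis
  proof (rule discrete_imp_closed[OF \<delta>(1)], intro ballI impI)
    fix x y assume "x \<in> S" "y \<in> S" "dist y x < \<delta>"
    then show "y = x"
      using \<delta>(2)[of "y - x"] lattice_diff[of y x] assms by (auto simp: dist_norm)
  qed
qed

lemma lattice_coordinates_zero:
  assumes "of_int m * (\<alpha> - 1) + of_int n * (\<alpha> * (\<alpha> - 1)) = 0"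
  shows "m = 0 \<and> n = 0"
proof -
  have "(\<alpha> - 1) * (of_int m + of_int n * \<alpha>) = 0"
    using assms by (simp add: algebra_simps)
  moreover have "\<alpha> \<noteq> 1" using nonreal by auto
  ultimately have z: "of_int m + of_int n * \<alpha> = 0" by simp
  have "Im (of_int m + of_int n * \<alpha>) = 0" unfolding z by simp
  then have "n = 0" using nonreal by simp
  then show ?thesis using z by simp
qed

section \<open>Compactness and covering\<close>

lemma mem_translate_tile: "x \<in> translate tile v \<longleftrightarrow> (\<exists>s. digits a s \<and> x = point s + v)"
  unfolding translate_def tile_def by blast

text \<open>
The sequences with bounded digits form a product of finite sets, and each of the conditions on
windows depends on finitely many coordinates only.
\<close>

lemma compact_digits: "compact {s. digits a s}"
proof -
  have closed_coordinate: "closed {s :: nat \<Rightarrow> int. P (s n)}" for P n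
  proof -
    have "closed ((\<lambda>s :: nat \<Rightarrow> int. s n) -` {x. P x})"
      by (rule closed_vimage) (simp_all add: closed_def open_discrete)
    then show ?thesis by (simp add: vimage_def)
  qed
  have "closed {s. digits a s}"
    unfolding digits_def imp_conv_disj
    by (intro closed_Collect_conj closed_Collect_all closed_Collect_disj closed_coordinate)
  moreover have "compact (PiE UNIV (\<lambda>_ :: nat. {0..a - 1}))"
    using compactin_PiE[of "\<lambda>_. euclidean" UNIV "\<lambda>_ :: nat. {0..a - 1}"]
    by (simp add: euclidean_product_topology finite_imp_compact)
  moreover have "{s. digits a s} \<subseteq> PiE UNIV (\<lambda>_. {0..a - 1})"
    using digits_nonneg digits_le by auto
  ultimately show ?thesis
    by (metis closed_Int_compact inf.absorb1)
qed

lemma compact_tile: "compact tile"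
proof -
  let ?f = "\<lambda>i s. of_int (s i) * \<alpha> ^ (i + 2)"
  let ?D = "{s. digits a s}"
  have bound: "norm (?f i s) \<le> of_int (a - 1) * norm \<alpha> ^ i" if "s \<in> ?D" for i s
  proof -
    have "norm (?f i s) = norm (of_int (s i) * \<alpha> ^ i) * norm \<alpha> ^ 2"
      by (simp only: norm_mult norm_power power_add mult.assoc)
    also have "\<dots> \<le> norm (of_int (s i) * \<alpha> ^ i) * 1"
      using contracting by (intro mult_left_mono power_le_one) auto
    also have "\<dots> \<le> of_int (a - 1) * norm \<alpha> ^ i"
      using norm_term_le[of s "a - 1" i] digits_abs_le that by simp
    finally show ?thesis .
  qed
  have lim: "uniform_limit ?D (\<lambda>n s. \<Sum>i<n. ?f i s) (\<lambda>s. \<Sum>i. ?f i s) sequentially"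
    by (rule Weierstrass_m_test[of _ _ "\<lambda>i. of_int (a - 1) * norm \<alpha> ^ i"])
       (use bound contracting in \<open>auto intro!: summable_mult summable_geometric\<close>)
  have coordinate: "continuous_on ?D (\<lambda>s. of_int (s i) :: complex)" for i
  proof -
    have "continuous_on UNIV (of_int :: int \<Rightarrow> complex)"
      by (simp add: continuous_on_open_vimage open_discrete)
    then show ?thesis
      by (rule continuous_on_compose2) (auto intro: continuous_on_subset[OF continuous_on_product_coordinates])
  qed
  have "continuous_on ?D (\<lambda>s. \<Sum>i. ?f i s)"
    by (rule uniform_limit_theorem[OF _ lim])
       (auto intro!: always_eventually continuous_intros coordinate)
  then show ?thesis
    unfolding tile_def point_def by (rule compact_continuous_image[OF _ compact_digits])
qed

lemma closed_union_of_translates: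
  assumes "S \<subseteq> lattice"
  shows "closed (\<Union>v\<in>S. translate tile v)"
proof -
  have "closed (\<Union>x\<in>tile. \<Union>y\<in>S. {x + y})"
    by (rule compact_closed_sums[OF compact_tile closed_lattice_subset[OF assms]])
  also have "(\<Union>x\<in>tile. \<Union>y\<in>S. {x + y}) = (\<Union>v\<in>S. translate tile v)"
    unfolding translate_def by auto
  finally show ?thesis .
qed

lemma point_cong_digit_value:
  assumes "\<And>i. i \<ge> k \<Longrightarrow> s i = 0"
  shows "point s - of_int (digit_value a s k) \<in> lattice"
proof -
  have "point s - of_int (digit_value a s k) =
    (\<Sum>i<k. of_int (s i) * (\<alpha> ^ (i + 2) - of_int (weight a (i + 2))))"
    using point_finite[of k s] assms unfolding digit_value_def
    by (simp only: right_diff_distrib sum_subtractf of_int_sum of_int_mult)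
  then show ?thesis
    by (simp only: lattice_sum lattice_of_int_mult power_cong_weight)
qed

text \<open>
Two elements of $\mathbb{Z}[\alpha]$ of the same weight differ by a lattice vector, and every
nonnegative weight is the digit value of some finite word.
\<close>

lemma nonneg_weight_in_translate:
  fixes p q :: int
  assumes "0 \<le> p * weight a k + q * weight a (k + 1) + weight a j"
  shows "\<exists>v\<in>lattice. of_int p * \<alpha> ^ k + of_int q * \<alpha> ^ (k + 1) + \<alpha> ^ j \<in> translate tile v"
proof -
  let ?w = "weight a"
  define N x where "N = p * ?w k + q * ?w (k + 1) + ?w j"
    and "x = of_int p * \<alpha> ^ k + of_int q * \<alpha> ^ (k + 1) + \<alpha> ^ j"
  define K where "K = Suc (nat N)"
  have "int K \<le> ?w (K + 2)" by (rule weight_ge_index[OF a])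
  then have "0 \<le> N" "N < ?w (K + 2)"
    using assms by (auto simp: N_def K_def)
  then obtain s where s: "digits a s" "\<forall>i\<ge>K. s i = 0" "digit_value a s K = N"
    using digit_expansion_exists[OF a] by blast
  have "x - of_int N = of_int p * (\<alpha> ^ k - of_int (?w k)) + of_int q * (\<alpha> ^ (k + 1) - of_int (?w (k + 1)))
    + (\<alpha> ^ j - of_int (?w j))"
    by (simp add: x_def N_def algebra_simps)
  then have "x - of_int N \<in> lattice"
    by (simp only: lattice_add lattice_of_int_mult power_cong_weight)
  then have "x - point s \<in> lattice"
    using lattice_diff[OF _ point_cong_digit_value[of K s]] s by fastforce
  moreover have "x \<in> translate tile (x - point s)"
    unfolding translate_def tile_def using s(1) by (intro image_eqI[of _ _ "point s"]) auto
  ultimately show ?thesis unfolding x_def by blast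
qed

text \<open>
Rounding $z/\alpha^k$ to $p + q\alpha$ gives an approximation $p\alpha^k + q\alpha^{k+1}$ of
\<open>z\<close> with an error of order $|\alpha|^k$. Its weight may be negative, but adding a high
power $\alpha^j$ makes the weight nonnegative and changes the point little.
\<close>

lemma dense_translates:
  assumes "\<epsilon> > 0"
  shows "\<exists>v\<in>lattice. \<exists>x\<in>translate tile v. dist x z < \<epsilon>"
proof -
  let ?w = "weight a"
  have "\<exists>k. norm \<alpha> ^ k < \<epsilon> / 3"
    using real_arch_pow_inv[of "\<epsilon> / 3" "norm \<alpha>"] assms contracting by simp
  then obtain k where k: "norm \<alpha> ^ k < \<epsilon> / 3" by blast
  define y where "y = z / \<alpha> ^ k"
  define q' where "q' = Im y / Im \<alpha>"
  define p' where "p' = Re y - q' * Re \<alpha>"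
  define p q where "p = \<lfloor>p'\<rfloor>" and "q = \<lfloor>q'\<rfloor>"
  have y: "y = of_real p' + of_real q' * \<alpha>"
    using nonreal by (simp add: complex_eq_iff p'_def q'_def)
  have "norm (of_int p + of_int q * \<alpha> - y) \<le> 2"
  proof -
    have "of_int p + of_int q * \<alpha> - y = of_real (of_int p - p') + of_real (of_int q - q') * \<alpha>"
      by (simp add: y algebra_simps)
    also have "norm \<dots> \<le> \<bar>of_int p - p'\<bar> + \<bar>of_int q - q'\<bar> * norm \<alpha>"
      by (rule order_trans[OF norm_triangle_ineq]) (simp only: norm_mult norm_of_real order_refl)
    also have "\<dots> \<le> 1 + 1 * 1"
      using contracting by (intro add_mono mult_mono) (auto simp: p_def q_def abs_if, linarith+)
    finally show ?thesis by simp
  qed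
  moreover have "z = \<alpha> ^ k * y"
    using alpha_neq_0 by (simp add: y_def)
  ultimately have near: "norm (of_int p * \<alpha> ^ k + of_int q * \<alpha> ^ (k + 1) - z) \<le> 2 * norm \<alpha> ^ k"
  proof -
    assume *: "norm (of_int p + of_int q * \<alpha> - y) \<le> 2" "z = \<alpha> ^ k * y"
    have "of_int p * \<alpha> ^ k + of_int q * \<alpha> ^ (k + 1) - z = \<alpha> ^ k * (of_int p + of_int q * \<alpha> - y)"
      unfolding *(2) by (simp add: algebra_simps)
    then show ?thesis
      using mult_left_mono[OF *(1), of "norm \<alpha> ^ k"] by (simp add: norm_mult norm_power mult.commute)
  qed
  define j where "j = k + nat (\<bar>p * ?w k\<bar> + \<bar>q * ?w (k + 1)\<bar>) + 2"
  have "int (k + nat (\<bar>p * ?w k\<bar> + \<bar>q * ?w (k + 1)\<bar>)) \<le> ?w j"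
    unfolding j_def by (rule weight_ge_index[OF a])
  then have "0 \<le> p * ?w k + q * ?w (k + 1) + ?w j"
    by linarith
  then obtain v where v: "v \<in> lattice"
    "of_int p * \<alpha> ^ k + of_int q * \<alpha> ^ (k + 1) + \<alpha> ^ j \<in> translate tile v"
    using nonneg_weight_in_translate by blast
  have "dist (of_int p * \<alpha> ^ k + of_int q * \<alpha> ^ (k + 1) + \<alpha> ^ j) z
      = norm ((of_int p * \<alpha> ^ k + of_int q * \<alpha> ^ (k + 1) - z) + \<alpha> ^ j)"
    by (simp add: dist_norm algebra_simps)
  also have "\<dots> \<le> 2 * norm \<alpha> ^ k + norm \<alpha> ^ j"
    by (rule order_trans[OF norm_triangle_ineq add_mono[OF near]]) (simp add: norm_power)
  also have "norm \<alpha> ^ j \<le> norm \<alpha> ^ k"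
    using contracting by (intro power_decreasing) (auto simp: j_def)
  finally have "dist (of_int p * \<alpha> ^ k + of_int q * \<alpha> ^ (k + 1) + \<alpha> ^ j) z < \<epsilon>"
    using k by simp
  then show ?thesis using v by blast
qed

theorem translates_cover: "(\<Union>v\<in>lattice. translate tile v) = UNIV"
proof (intro equalityI subset_UNIV subsetI)
  fix z
  have "z \<in> closure (\<Union>v\<in>lattice. translate tile v)"
    unfolding closure_approachable using dense_translates by blast
  then show "z \<in> (\<Union>v\<in>lattice. translate tile v)"
    unfolding closure_closed[OF closed_union_of_translates[OF subset_refl]] .
qed

text \<open>
A common point can be replaced by one with a finite expansion, because truncated words remain
admissible and the interior is open; \<open>finite_expansion_unique\<close> applies to that point.
\<close>

theorem interior_meets_only_itself:
  assumes v: "v \<in> lattice" and w: "w \<in> lattice"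
    and meets: "interior (translate tile v) \<inter> translate tile w \<noteq> {}"
  shows "v = w"
proof -
  obtain y where y: "y \<in> interior (translate tile v)" "y \<in> translate tile w"
    using meets by blast
  then obtain s where s: "digits a s" "y = point s + w"
    unfolding mem_translate_tile by blast
  have int: "point s + w \<in> interior (translate tile v)"
    using y(1) s(2) by simp
  have lim: "(\<lambda>N. (\<Sum>i<N. of_int (s i) * \<alpha> ^ (i + 2)) + w) \<longlonglongrightarrow> point s + w"
    by (rule tendsto_add[OF sums_point[OF s(1), unfolded sums_def] tendsto_const])
  have "\<forall>\<^sub>F N in sequentially. (\<Sum>i<N. of_int (s i) * \<alpha> ^ (i + 2)) + w \<in> interior (translate tile v)"
    by (rule topological_tendstoD[OF lim open_interior int])
  then obtain N where N: "(\<Sum>i<N. of_int (s i) * \<alpha> ^ (i + 2)) + w \<in> interior (translate tile v)"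
    unfolding eventually_sequentially by blast
  define t where "t = (\<lambda>i. if i < N then s i else 0)"
  have t: "digits a t"
    unfolding digits_def
  proof (intro conjI allI impI)
    fix n show "0 \<le> t n" "t n \<le> a - 1"
      using digits_nonneg[OF s(1)] digits_le[OF s(1)] a by (auto simp: t_def)
  next
    fix n assume top: "t (n + 2) = a - 1" "t (n + 1) = a - 1"
    then have "n + 2 < N" using a by (auto simp: t_def split: if_splits)
    then show "t n = 0"
      using digits_top2[OF s(1), of n] top by (simp add: t_def)
  next
    fix n assume top: "t (n + 3) = a - 1" "t (n + 2) = a - 1"
    then have "n + 3 < N" using a by (auto simp: t_def split: if_splits)
    then show "t n = 0"
      using digits_top3[OF s(1), of n] top by (simp add: t_def)
  qed
  have fin: "t i = 0" if "i \<ge> N" for i using that by (simp add: t_def)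
  have fin_sum: "point t = (\<Sum>i<N. of_int (s i) * \<alpha> ^ (i + 2))"
    using point_finite[of N t] fin by (simp add: t_def)
  have "point t + w \<in> translate tile v"
    using subsetD[OF interior_subset N] unfolding fin_sum .
  then obtain s' where s': "digits a s'" "point t + w = point s' + v"
    unfolding mem_translate_tile by blast
  have eq: "point t - point s' = v - w"
    using s'(2) by (simp add: algebra_simps)
  have "s' = t"
    by (rule finite_expansion_unique[OF t fin s'(1)]) (simp_all only: eq lattice_diff[OF v w])
  then show ?thesis using eq by simp
qed

section \<open>The boundary\<close>

lemma neighbour_coordinates:
  assumes "x \<in> tile" "x \<in> translate tile (of_int m * (\<alpha> - 1) + of_int n * (\<alpha> * (\<alpha> - 1)))"
  shows "\<bar>m\<bar> \<le> 1 \<and> \<bar>n\<bar> \<le> 1"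
proof -
  obtain s where s: "digits a s" "x = point s" using assms(1) unfolding tile_def by blast
  obtain s' where s': "digits a s'" "x = point s' + (of_int m * (\<alpha> - 1) + of_int n * (\<alpha> * (\<alpha> - 1)))"
    using assms(2) unfolding mem_translate_tile by blast
  have diff: "point s - point s' = of_int m * (\<alpha> - 1) + of_int n * (\<alpha> * (\<alpha> - 1))"
    unfolding s(2)[symmetric] by (subst s'(2)) simp
  obtain E where carries: "E 0 = n \<and> E 1 = - m \<and> E 2 = - E 0 \<and>
    (\<forall>k. E (k + 3) = - (s k - s' k) + E (k + 2) - a * E (k + 1) + E k) \<and> (\<forall>k. \<bar>E k\<bar> \<le> 1)"
    using carries_of_coincidence[OF s(1) s'(1) diff] by (rule exE)
  then have E: "E 0 = n" "E 1 = - m" "\<forall>k. \<bar>E k\<bar> \<le> 1"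
    by - ((elim conjE, assumption)+)
  then show ?thesis
    using spec[OF E(3), of 0] spec[OF E(3), of 1] by simp
qed

lemma translate_0 [simp]: "translate S 0 = S"
  by (simp add: translate_def)

text \<open>
The translates other than the tile itself have a closed union, and by the covering its complement
is an open subset of the tile. Hence a point of the tile outside its interior belongs to another
translate.
\<close>

theorem frontier_tile:
  "frontier tile = (\<Union>v \<in> {of_int m * (\<alpha> - 1) + of_int n * (\<alpha> * (\<alpha> - 1)) | m n.
      \<bar>m\<bar> \<le> 1 \<and> \<bar>n\<bar> \<le> 1 \<and> (m, n) \<noteq> (0, 0)}. tile \<inter> translate tile v)"
    (is "_ = (\<Union>v \<in> ?B. tile \<inter> translate tile v)")
proof (intro equalityI subsetI)
  have closed: "closed tile" using compact_tile by (rule compact_imp_closed)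
  fix x
  assume "x \<in> frontier tile"
  then have x: "x \<in> tile" "x \<notin> interior tile"
    using closed unfolding frontier_def by (simp_all add: closure_closed)
  \<comment> \<open>The union of the other translates is closed as well, since all subsets of the lattice are closed.\<close>
  let ?others = "\<Union>v\<in>lattice - {0}. translate tile v"
  have "- ?others \<subseteq> tile"
  proof
    fix y assume y: "y \<in> - ?others"
    obtain v where v: "v \<in> lattice" "y \<in> translate tile v"
      using translates_cover by blast
    then have "v = 0" using y by blast
    then show "y \<in> tile" using v(2) by simp
  qed
  moreover have "open (- ?others)"
    by (rule open_Compl[OF closed_union_of_translates]) blast
  ultimately have "x \<in> ?others"
    using x(2) interior_maximal by blast
  then obtain v where v: "v \<in> lattice" "v \<noteq> 0" "x \<in> translate tile v" by blast
  then obtain m n where mn: "v = of_int m * (\<alpha> - 1) + of_int n * (\<alpha> * (\<alpha> - 1))"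
    unfolding lattice_iff by blast
  have "\<bar>m\<bar> \<le> 1 \<and> \<bar>n\<bar> \<le> 1"
    by (rule neighbour_coordinates[OF x(1)]) (use v(3) mn in simp)
  moreover have "(m, n) \<noteq> (0, 0)" using v(2) mn by auto
  ultimately have "v \<in> ?B" using mn by blast
  then show "x \<in> (\<Union>v \<in> ?B. tile \<inter> translate tile v)"
    using x(1) v(3) by blast
next
  fix x
  assume "x \<in> (\<Union>v \<in> ?B. tile \<inter> translate tile v)"
  then obtain m n where mn: "(m, n) \<noteq> (0, 0)"
    and x: "x \<in> tile" "x \<in> translate tile (of_int m * (\<alpha> - 1) + of_int n * (\<alpha> * (\<alpha> - 1)))"
    by blast
  let ?v = "of_int m * (\<alpha> - 1) + of_int n * (\<alpha> * (\<alpha> - 1))"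
  have v: "?v \<in> lattice" unfolding lattice_iff by blast
  have "?v \<noteq> 0" using lattice_coordinates_zero[of m n] mn by blast
  then have "interior (translate tile 0) \<inter> translate tile ?v = {}"
    using interior_meets_only_itself[OF lattice_zero v] by metis
  then have "x \<notin> interior tile" using x(2) by (simp only: translate_0) blast
  then show "x \<in> frontier tile"
    using x(1) closure_subset unfolding frontier_def by blast
qed

section \<open>The two corner points\<close>

text \<open>
The four rotations of the periodic word $(a-1)(a-1)00(a-1)(a-1)00\dots$.
\<close>

definition corner_digits :: "nat \<Rightarrow> nat \<Rightarrow> int" where
  "corner_digits c k = (if (k + c) mod 4 < 2 then a - 1 else 0)"

lemma corner_digits_eq_top: "corner_digits c k = a - 1 \<longleftrightarrow> (k + c) mod 4 < 2"
  using a by (simp add: corner_digits_def)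

lemma shifted_mod_4:
  fixes r :: nat
  assumes "r mod 4 < 2"
  shows "\<not> ((r + 2) mod 4 < 2 \<and> (r + 1) mod 4 < 2)" "\<not> ((r + 3) mod 4 < 2 \<and> (r + 2) mod 4 < 2)"
proof -
  have "(r + 2) mod 4 = (r mod 4 + 2) mod 4"
    by (rule mod_add_left_eq[symmetric])
  moreover have "r mod 4 + 2 < 4" using assms by simp
  ultimately have "(r + 2) mod 4 = r mod 4 + 2" by (simp only: mod_less)
  then show "\<not> ((r + 2) mod 4 < 2 \<and> (r + 1) mod 4 < 2)" "\<not> ((r + 3) mod 4 < 2 \<and> (r + 2) mod 4 < 2)"
    by simp_all
qed

lemma digits_corner_digits: "digits a (corner_digits c)"
  unfolding digits_def corner_digits_eq_top
proof (intro conjI allI impI)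
  fix n
  show "0 \<le> corner_digits c n" "corner_digits c n \<le> a - 1"
    using a by (simp_all add: corner_digits_def)
next
  fix n
  assume "(n + 2 + c) mod 4 < 2" "(n + 1 + c) mod 4 < 2"
  then have "\<not> (n + c) mod 4 < 2"
    using shifted_mod_4[of "n + c"] by (metis add.assoc add.commute)
  then show "corner_digits c n = 0" by (simp add: corner_digits_def)
next
  fix n
  assume "(n + 3 + c) mod 4 < 2" "(n + 2 + c) mod 4 < 2"
  then have "\<not> (n + c) mod 4 < 2"
    using shifted_mod_4[of "n + c"] by (metis add.assoc add.commute)
  then show "corner_digits c n = 0" by (simp add: corner_digits_def)
qed

lemma corner_in_tile: "point (corner_digits c) \<in> tile"
  unfolding tile_def using digits_corner_digits by (intro imageI) simp

lemma corner_in_translate: "point (corner_digits c) + v \<in> translate tile v"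
  unfolding translate_def using corner_in_tile by (rule imageI)

text \<open>
Passing to the next rotation divides the point by $\alpha$ after its leading term is removed. After
four steps this gives an equation for the first point, which the identity
$\alpha^4 - 1 = (a-1)(\alpha^2 + \alpha^3)$ solves.
\<close>

lemma corner_points:
  "point (corner_digits 0) = -1" "point (corner_digits 1) = of_int (a - 1) * \<alpha> ^ 2 - \<alpha> ^ 3"
  "point (corner_digits 2) = - (\<alpha> ^ 2)" "point (corner_digits 3) = - \<alpha>"
proof -
  have step: "point (corner_digits c) = of_int (corner_digits c 0) * \<alpha> ^ 2 + \<alpha> * point (corner_digits (c + 1))" for c
  proof -
    have "(\<lambda>n. corner_digits c (Suc n)) = corner_digits (c + 1)"
      by (rule ext) (simp add: corner_digits_def)
    then show ?thesis
      using point_Suc[of "corner_digits c", OF digits_abs_le[OF digits_corner_digits]] by simp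
  qed
  have "corner_digits 4 = corner_digits 0"
    by (rule ext) (simp add: corner_digits_def)
  then have p4: "point (corner_digits 3) = \<alpha> * point (corner_digits 0)"
    using step[of 3] by (simp add: corner_digits_def)
  have p1: "point (corner_digits 0) = of_int (a - 1) * \<alpha> ^ 2 + \<alpha> * point (corner_digits 1)"
    using step[of 0] by (simp add: corner_digits_def)
  have p2: "point (corner_digits 1) = of_int (a - 1) * \<alpha> ^ 2 + \<alpha> * point (corner_digits 2)"
    using step[of 1] by (simp add: corner_digits_def numeral_2_eq_2)
  have p3: "point (corner_digits 2) = \<alpha> * point (corner_digits 3)"
    using step[of 2] by (simp add: corner_digits_def)
  have "(\<alpha> + 1) * (\<alpha> ^ 3 - (of_int a * \<alpha> ^ 2 - \<alpha> + 1)) = 0"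
    using root by simp
  then have quartic: "\<alpha> ^ 4 - 1 = of_int (a - 1) * (\<alpha> ^ 2 + \<alpha> ^ 3)"
    by (simp add: algebra_simps power2_eq_square power3_eq_cube power4_eq_xxxx)
  have "of_int (a - 1) * (\<alpha> ^ 2 + \<alpha> ^ 3) + \<alpha> ^ 4 * point (corner_digits 0) = point (corner_digits 0)"
  proof -
    have "point (corner_digits 0) =
        of_int (a - 1) * \<alpha> ^ 2 + \<alpha> * (of_int (a - 1) * \<alpha> ^ 2 + \<alpha> * (\<alpha> * (\<alpha> * point (corner_digits 0))))"
      by (rule p1[unfolded p2 p3 p4])
    also have "\<dots> = of_int (a - 1) * (\<alpha> ^ 2 + \<alpha> ^ 3) + \<alpha> ^ 4 * point (corner_digits 0)"
      by (simp add: algebra_simps power2_eq_square power3_eq_cube power4_eq_xxxx)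
    finally show ?thesis ..
  qed
  then have fixed: "\<alpha> ^ 4 - 1 + \<alpha> ^ 4 * point (corner_digits 0) = point (corner_digits 0)"
    unfolding quartic .
  have "(\<alpha> ^ 4 - 1) * (point (corner_digits 0) + 1) =
      \<alpha> ^ 4 - 1 + \<alpha> ^ 4 * point (corner_digits 0) - point (corner_digits 0)"
    by (simp add: algebra_simps)
  also have "\<dots> = 0" unfolding fixed by simp
  finally have "(\<alpha> ^ 4 - 1) * (point (corner_digits 0) + 1) = 0" .
  moreover have "\<alpha> ^ 4 \<noteq> 1"
  proof
    assume "\<alpha> ^ 4 = 1"
    then have "norm \<alpha> ^ 4 = 1" by (metis norm_one norm_power)
    then show False using contracting power_less_one_iff[of "norm \<alpha>" 4] by simp
  qed
  ultimately have "point (corner_digits 0) + 1 = 0" by simp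
  then show p0: "point (corner_digits 0) = -1" by (simp add: eq_neg_iff_add_eq_0)
  show c3: "point (corner_digits 3) = - \<alpha>" unfolding p4 p0 by simp
  show c2: "point (corner_digits 2) = - (\<alpha> ^ 2)" unfolding p3 c3 by (simp add: power2_eq_square)
  show "point (corner_digits 1) = of_int (a - 1) * \<alpha> ^ 2 - \<alpha> ^ 3"
    unfolding p2 c2 by (simp add: power2_eq_square power3_eq_cube)
qed

lemma periodic_4: "(\<And>k. f (k + 4) = f k) \<Longrightarrow> f k = f (k mod 4)" for f :: "nat \<Rightarrow> 'b"
proof (induction k rule: less_induct)
  case (less k)
  show ?case
  proof (cases "k < 4")
    case False
    then obtain j where j: "k = j + 4" by (metis add.commute le_Suc_ex not_less)
    have "f k = f j" unfolding j by (rule less.prems)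
    also have "\<dots> = f (j mod 4)" by (rule less.IH) (simp add: j, rule less.prems)
    finally show ?thesis unfolding j by simp
  qed simp
qed

text \<open>
The two corners $(m, n) = (1, 1)$ and $(-1, 1)$ start the carries with $1, -1$ and $1, 1$; the maximal
digits sit where the next carry is $-1$.
\<close>

lemma corner_intersection_unique:
  assumes x: "x \<in> tile" "x \<in> translate tile v" and v: "v = of_int m * (\<alpha> - 1) + \<alpha> * (\<alpha> - 1)"
    and m: "m = 1 \<and> c = 0 \<or> m = -1 \<and> c = 3"
  shows "x = point (corner_digits c)"
proof -
  obtain s where s: "digits a s" "x = point s" using x(1) unfolding tile_def by blast
  obtain s' where s': "digits a s'" "x = point s' + (of_int m * (\<alpha> - 1) + \<alpha> * (\<alpha> - 1))"
    using x(2) unfolding mem_translate_tile v by blast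
  have "point s - point s' = of_int m * (\<alpha> - 1) + of_int 1 * (\<alpha> * (\<alpha> - 1))"
    unfolding s(2)[symmetric] by (subst s'(2)) simp
  then obtain E where carries: "E 0 = 1 \<and> E 1 = - m \<and> E 2 = - E 0 \<and>
    (\<forall>k. E (k + 3) = - (s k - s' k) + E (k + 2) - a * E (k + 1) + E k) \<and> (\<forall>k. \<bar>E k\<bar> \<le> 1)"
    by (rule exE[OF carries_of_coincidence[OF s(1) s'(1)]])
  then have E: "E 0 = 1" "E 1 = - m" "E 2 = - E 0"
    "\<And>k. E (k + 3) = - (s k - s' k) + E (k + 2) - a * E (k + 1) + E k" "\<And>k. \<bar>E k\<bar> \<le> 1"
    by - ((elim conjE, (assumption | erule spec))+)
  have corner: "\<bar>E 0\<bar> = 1" "\<bar>E 1\<bar> = 1" using E(1,2) m by auto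
  note cc = corner_carries[of a s s' E, OF a s(1) s'(1) E(4,3,5) corner]
  have per: "E (k + 1) = E (k mod 4 + 1)" for k
  proof (rule periodic_4[of "\<lambda>k. E (k + 1)"])
    show "E (k + 4 + 1) = E (k + 1)" for k
      using cc(1)[of "k + 1"] cc(1)[of "k + 3"] by (simp add: numeral_eq_Suc)
  qed
  have vals: "E (0 + 1) = - m" "E (1 + 1) = -1" "E (2 + 1) = m" "E (3 + 1) = 1"
    using E(1-3) cc(1)[of 1] cc(1)[of 2] by (simp_all add: numeral_eq_Suc)
  have digit: "s k = corner_digits c k" for k
  proof -
    have cases: "k mod 4 = 0 \<or> k mod 4 = 1 \<or> k mod 4 = 2 \<or> k mod 4 = 3" by presburger
    have shift: "(k + c) mod 4 = (k mod 4 + c) mod 4"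
      by (rule mod_add_left_eq[symmetric])
    have "E (k + 1) = (if k mod 4 = 0 then - m else if k mod 4 = 1 then -1 else if k mod 4 = 2 then m else 1)"
      unfolding per[of k] using cases by (elim disjE) (simp_all only: vals, simp_all)
    moreover have "(k mod 4 + c) mod 4 < 2 \<longleftrightarrow> (if c = 0 then k mod 4 < 2 else k mod 4 = 1 \<or> k mod 4 = 2)"
      using cases m by (elim disjE conjE) (simp_all only:, simp_all)
    ultimately have E1: "E (k + 1) = -1 \<longleftrightarrow> (k + c) mod 4 < 2"
      unfolding shift using cases m by (elim disjE conjE) (simp_all only:, simp_all)
    show ?thesis
      unfolding cc(2)[of k] corner_digits_def E1 ..
  qed
  have "s = corner_digits c" by (rule ext) (rule digit)
  then show ?thesis unfolding s(2) by (rule arg_cong)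
qed

theorem corner_minus_one: "tile \<inter> translate tile ((1 + \<alpha>) * (\<alpha> - 1)) = {-1}"
proof (intro equalityI subsetI)
  fix x assume x: "x \<in> tile \<inter> translate tile ((1 + \<alpha>) * (\<alpha> - 1))"
  have "x = point (corner_digits 0)"
    by (rule corner_intersection_unique[OF IntD1[OF x] IntD2[OF x], of 1]) (simp_all add: algebra_simps)
  then show "x \<in> {-1}" using corner_points(1) by simp
next
  fix x :: complex assume "x \<in> {-1}"
  then have x: "x = point (corner_digits 0)" "x = point (corner_digits 2) + (1 + \<alpha>) * (\<alpha> - 1)"
    using corner_points(1,3) by (simp_all add: algebra_simps power2_eq_square)
  show "x \<in> tile \<inter> translate tile ((1 + \<alpha>) * (\<alpha> - 1))"
  proof
    show "x \<in> tile" unfolding x(1) by (rule corner_in_tile)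
    show "x \<in> translate tile ((1 + \<alpha>) * (\<alpha> - 1))" unfolding x(2) by (rule corner_in_translate)
  qed
qed

theorem corner_minus_alpha: "tile \<inter> translate tile ((\<alpha> - 1) * (\<alpha> - 1)) = {- \<alpha>}"
proof (intro equalityI subsetI)
  fix x assume x: "x \<in> tile \<inter> translate tile ((\<alpha> - 1) * (\<alpha> - 1))"
  have "x = point (corner_digits 3)"
    by (rule corner_intersection_unique[OF IntD1[OF x] IntD2[OF x], of "-1"]) (simp_all add: algebra_simps)
  then show "x \<in> {- \<alpha>}" using corner_points(4) by simp
next
  fix x assume "x \<in> {- \<alpha>}"
  then have x: "x = point (corner_digits 3)" "x = point (corner_digits 1) + (\<alpha> - 1) * (\<alpha> - 1)"
    using corner_points(2,4) root by (simp_all add: algebra_simps power2_eq_square)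
  show "x \<in> tile \<inter> translate tile ((\<alpha> - 1) * (\<alpha> - 1))"
  proof
    show "x \<in> tile" unfolding x(1) by (rule corner_in_tile)
    show "x \<in> translate tile ((\<alpha> - 1) * (\<alpha> - 1))" unfolding x(2) by (rule corner_in_translate)
  qed
qed

end

section \<open>The tiling\<close>

text \<open>
Comparing both sides of the factorization at $0$, $1$ and $-1$ yields
$\beta + 2\,\mathrm{Re}\,\alpha = a$.
\<close>

lemma cubic_tile_of_factorization:
  assumes a: "a \<ge> 2"
    and factorization: "\<And>x :: complex. x ^ 3 - of_int a * x ^ 2 + x - 1 = (x - of_real \<beta>) * (x - \<alpha>) * (x - cnj \<alpha>)"
    and beta: "\<beta> > 1" and nonreal: "\<alpha> \<notin> \<real>" and norm_alpha: "norm \<alpha> < 1"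
  shows "cubic_tile a \<alpha>"
proof
  show "\<alpha> ^ 3 = of_int a * \<alpha> ^ 2 - \<alpha> + 1"
    using factorization[of \<alpha>] by (simp add: algebra_simps)
  show "Im \<alpha> \<noteq> 0" using nonreal by (simp add: complex_is_Real_iff)
  \<comment> \<open>The product of the two conjugate factors at a real argument.\<close>
  define q where "q = (\<lambda>t. (t - Re \<alpha>) ^ 2 + Im \<alpha> ^ 2)"
  have real_factorization: "t ^ 3 - of_int a * t ^ 2 + t - 1 = (t - \<beta>) * q t" for t :: real
  proof -
    have "(of_real t - \<alpha>) * (of_real t - cnj \<alpha>) = of_real (q t)"
      by (simp add: complex_eq_iff q_def power2_eq_square algebra_simps)
    then have "(of_real (t ^ 3 - of_int a * t ^ 2 + t - 1) :: complex) = of_real ((t - \<beta>) * q t)"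
      using factorization[of "of_real t"] by (simp add: mult.assoc)
    then show ?thesis by (simp only: of_real_eq_iff)
  qed
  have "\<beta> + 2 * Re \<alpha> = of_int a"
    using real_factorization[of 0] real_factorization[of 1] real_factorization[of "-1"]
    by (simp add: q_def power2_eq_square algebra_simps)
  then show "of_int a - 2 * Re \<alpha> > 1" using beta by simp
qed (use a norm_alpha in auto)

theorem proposition5p1:
  fixes a :: int and \<beta> :: real and \<alpha> \<gamma> u :: complex and R \<Lambda> B :: "complex set"
  assumes a: "a \<ge> 2"
    and factorization:
      "\<And>x :: complex. x ^ 3 - of_int a * x ^ 2 + x - 1 = (x - of_real \<beta>) * (x - \<alpha>) * (x - \<gamma>)"
    and beta: "\<beta> > 1"
    and nonreal: "\<alpha> \<notin> \<real>" "\<gamma> \<notin> \<real>"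
    and conj: "\<gamma> = cnj \<alpha>"
    and norm_alpha: "norm \<alpha> < 1"
    and u: "u = \<alpha> - 1"
    and R: "R = Rtile a \<alpha>"
    and Lambda: "\<Lambda> = int_span2 u (\<alpha> * u)"
    and B: "B = {u, - u, \<alpha> * u, - (\<alpha> * u), (1 + \<alpha>) * u, - ((1 + \<alpha>) * u), (1 - \<alpha>) * u, - ((1 - \<alpha>) * u)}"
  shows "UNIV = (\<Union>v\<in>\<Lambda>. translate R v) \<and>
    (\<forall>v\<in>\<Lambda>. \<forall>w\<in>\<Lambda>. interior (translate R v) \<inter> translate R w \<noteq> {} \<longrightarrow> v = w) \<and>
    frontier R = (\<Union>v\<in>B. R \<inter> translate R v) \<and>
    R \<inter> translate R ((1 + \<alpha>) * u) = {- 1} \<and>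
    R \<inter> translate R ((\<alpha> - 1) * u) = {- \<alpha>}"
proof -
  interpret cubic_tile a \<alpha>
    by (rule cubic_tile_of_factorization[OF a factorization[unfolded conj] beta nonreal(1) norm_alpha])
  have R_tile: "R = tile" unfolding R by (rule Rtile_eq_tile)
  have Lambda_lattice: "\<Lambda> = lattice" unfolding Lambda lattice_def u ..
  define S where "S = {of_int m * u + of_int n * (\<alpha> * u) | m n. \<bar>m\<bar> \<le> 1 \<and> \<bar>n\<bar> \<le> 1 \<and> (m, n) \<noteq> (0, 0)}"
  have "S = B"
  proof (intro equalityI)
    show "S \<subseteq> B"
    proof
      fix v assume "v \<in> S"
      then obtain m n where v: "v = of_int m * u + of_int n * (\<alpha> * u)"
        and mn: "\<bar>m\<bar> \<le> 1" "\<bar>n\<bar> \<le> 1" "(m, n) \<noteq> (0, 0)"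
        unfolding S_def by blast
      have "m = -1 \<or> m = 0 \<or> m = 1" "n = -1 \<or> n = 0 \<or> n = 1"
        using mn(1,2) by linarith+
      then show "v \<in> B"
        using mn(3) unfolding v B by (elim disjE) (simp_all add: algebra_simps)
    qed
  next
    have S: "of_int m * u + of_int n * (\<alpha> * u) \<in> S" if "\<bar>m\<bar> \<le> 1" "\<bar>n\<bar> \<le> 1" "(m, n) \<noteq> (0, 0)" for m n
      unfolding S_def using that by blast
    show "B \<subseteq> S"
      using S[of 1 0] S[of "-1" 0] S[of 0 1] S[of 0 "-1"] S[of 1 1] S[of "-1" "-1"] S[of 1 "-1"] S[of "-1" 1]
      unfolding B by (simp add: algebra_simps)
  qed
  then have "frontier tile = (\<Union>v\<in>B. tile \<inter> translate tile v)"
    using frontier_tile unfolding S_def u by simp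
  moreover have "\<forall>v\<in>lattice. \<forall>w\<in>lattice. interior (translate tile v) \<inter> translate tile w \<noteq> {} \<longrightarrow> v = w"
    using interior_meets_only_itself by blast
  ultimately show ?thesis
    unfolding R_tile Lambda_lattice u
    by (intro conjI translates_cover[symmetric] corner_minus_one corner_minus_alpha)
qed

end
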